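(* Let $J: L^2(0,1)\to L^2(0,1)$ be the simple integration operator $[Jx](s)=\int_0^s x(t)\,dt$ $(0\le s\le 1)$, let $C: L^2(0,1)\to L^2(0,1)$ be the continuous Cesàro operator $[Cx](s)=\frac{1}{s}\int_0^s x(t)\,dt$ $(0<s\le 1)$, and let $A:=C\circ J: L^2(0,1)\to L^2(0,1)$ be their composition. Then the singular values of the compact operator $A$ satisfy $$\sigma_n(A)\asymp \frac{1}{n^2}.$$ In other words, the operator $A$ is ill-posed of degree exactly $\mu(A)=2$.
   Context: $L^2(0,1)$ denotes the real Hilbert space of quadratically integrable real functions on the unit interval. The operator $J$ is injective, bounded and compact; $C$ is injective and bounded; hence $A=C\circ J$ is injective and compact. Explicitly, $[Ax](s)=\int_0^s \frac{s-t}{s}\,x(t)\,dt$. For an injective compact linear operator $A: X\to Y$ between infinite dimensional separable Hilbert spaces, $\{\sigma_n(A)\}_{n=1}^\infty$ denotes the non-increasing sequence of its singular values (tending to zero). Notation: for sequences of positive numbers $a_n,b_n$, $a_n\asymp b_n$ means that there are constants $0<\underline{c}\le\overline{c}<\infty$ with $\underline{c}\,b_n\le a_n\le\overline{c}\,b_n$ for all sufficiently large $n\in\mathbb{N}$. Degree of ill-posedness: the interval of ill-posedness of $A$ is $$[\underline{\mu}(A),\overline{\mu}(A)]=\left[\liminf_{n\to\infty}\frac{-\log\sigma_n(A)}{\log n},\ \limsup_{n\to\infty}\frac{-\log\sigma_n(A)}{\log n}\right]\subset[0,\infty],$$ and $A$ is called ill-posed of degree $\mu=\mu(A)\in(0,\infty)$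 if $\mu=\underline{\mu}(A)=\overline{\mu}(A)$. *)

theory Defs
  imports "HOL-Analysis.Analysis"
begin

section \<open>The Hilbert space of square integrable functions on the unit interval\<close>

abbreviation unit_measure :: "real measure"
  where "unit_measure \<equiv> lebesgue_on {0<..<1}"

definition sq_integrable :: "(real \<Rightarrow> real) \<Rightarrow> bool" where
  "sq_integrable f \<longleftrightarrow>
     f \<in> borel_measurable unit_measure \<and> integrable unit_measure (\<lambda>t. (f t)\<^sup>2)"

definition L2_rel :: "(real \<Rightarrow> real) \<Rightarrow> (real \<Rightarrow> real) \<Rightarrow> bool" where
  "L2_rel f g \<longleftrightarrow> sq_integrable f \<and> sq_integrable g \<and> (AE t in unit_measure. f t = g t)"

lemma finite_measure_unit: "finite_measure unit_measure"
  by (intro finite_measure_lebesgue_on) simp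

lemma emeasure_unit: "emeasure unit_measure (space unit_measure) = 1"
  by (simp add: emeasure_restrict_space)

lemma sq_integrable_measurable [measurable_dest]:
  "sq_integrable f \<Longrightarrow> f \<in> borel_measurable unit_measure"
  by (simp add: sq_integrable_def)

lemma sq_integrable_mult:
  assumes "sq_integrable f" "sq_integrable g"
  shows "integrable unit_measure (\<lambda>t. f t * g t)"
proof (rule Bochner_Integration.integrable_bound)
  show "integrable unit_measure (\<lambda>t. (f t)\<^sup>2 + (g t)\<^sup>2)"
    using assms by (simp add: sq_integrable_def)
  show "(\<lambda>t. f t * g t) \<in> borel_measurable unit_measure"
    using assms by (auto simp: sq_integrable_def)
  have "\<bar>a * b\<bar> \<le> a\<^sup>2 + b\<^sup>2" for a b :: real
  proof -
    have "2 * (\<bar>a\<bar> * \<bar>b\<bar>) \<le> a\<^sup>2 + b\<^sup>2"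
      using sum_squares_bound[of "\<bar>a\<bar>" "\<bar>b\<bar>"] by (simp add: mult.assoc)
    moreover have "0 \<le> \<bar>a\<bar> * \<bar>b\<bar>" by simp
    ultimately show ?thesis unfolding abs_mult by linarith
  qed
  then show "AE t in unit_measure. norm (f t * g t) \<le> norm ((f t)\<^sup>2 + (g t)\<^sup>2)"
    by simp
qed

lemma sq_integrable_const: "sq_integrable (\<lambda>t. c)"
  using finite_measure.integrable_const[OF finite_measure_unit]
  by (simp add: sq_integrable_def)

lemma sq_integrable_add:
  assumes "sq_integrable f" "sq_integrable g"
  shows "sq_integrable (\<lambda>t. f t + g t)"
proof -
  have "integrable unit_measure (\<lambda>t. (f t)\<^sup>2 + (g t)\<^sup>2 + 2 * (f t * g t))"
    using assms sq_integrable_mult[OF assms] 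
    by (intro Bochner_Integration.integrable_add integrable_mult_right) (auto simp: sq_integrable_def)
  then show ?thesis
    using assms by (auto simp: sq_integrable_def power2_sum algebra_simps)
qed

lemma sq_integrable_scale: "sq_integrable f \<Longrightarrow> sq_integrable (\<lambda>t. c * f t)"
  by (auto simp: sq_integrable_def power_mult_distrib)

lemma sq_integrable_integrable: "sq_integrable f \<Longrightarrow> integrable unit_measure f"
  using sq_integrable_mult[OF _ sq_integrable_const[of 1], of f] by simp

lemma part_equivp_L2_rel: "part_equivp L2_rel"
proof (rule part_equivpI)
  show "\<exists>f. L2_rel f f"
    by (rule exI[of _ "\<lambda>_. 0"]) (simp add: L2_rel_def sq_integrable_const)
  show "symp L2_rel"
    by (rule sympI) (auto simp: L2_rel_def elim: eventually_mono)
  show "transp L2_rel"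
    by (rule transpI) (auto simp: L2_rel_def)
qed

quotient_type L2 = "real \<Rightarrow> real" / partial: L2_rel
  by (rule part_equivp_L2_rel)

instantiation L2 :: real_inner
begin

lift_definition zero_L2 :: L2 is "\<lambda>_. 0"
  by (simp add: L2_rel_def sq_integrable_const)

lift_definition plus_L2 :: "L2 \<Rightarrow> L2 \<Rightarrow> L2" is "\<lambda>f g t. f t + g t"
  by (auto simp: L2_rel_def sq_integrable_add)

lift_definition uminus_L2 :: "L2 \<Rightarrow> L2" is "\<lambda>f t. - f t"
  by (auto simp: L2_rel_def sq_integrable_def)

lift_definition scaleR_L2 :: "real \<Rightarrow> L2 \<Rightarrow> L2" is "\<lambda>c f t. c * f t"
  by (auto simp: L2_rel_def sq_integrable_scale)

definition minus_L2 :: "L2 \<Rightarrow> L2 \<Rightarrow> L2" where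
  "minus_L2 x y = x + - y"

lift_definition inner_L2 :: "L2 \<Rightarrow> L2 \<Rightarrow> real"
  is "\<lambda>f g. LINT t|unit_measure. f t * g t"
  by (rule integral_cong_AE)
    (auto simp: L2_rel_def sq_integrable_def)

definition norm_L2 :: "L2 \<Rightarrow> real" where
  "norm_L2 x = sqrt (x \<bullet> x)"

definition sgn_L2 :: "L2 \<Rightarrow> L2" where
  "sgn_L2 x = inverse (norm x) *\<^sub>R x"

definition dist_L2 :: "L2 \<Rightarrow> L2 \<Rightarrow> real" where
  "dist_L2 x y = norm (x - y)"

definition uniformity_L2 :: "(L2 \<times> L2) filter" where
  "uniformity_L2 = (INF e\<in>{0<..}. principal {(x, y). dist x y < e})"

definition open_L2 :: "L2 set \<Rightarrow> bool" where
  "open_L2 U \<longleftrightarrow> (\<forall>x\<in>U. \<forall>\<^sub>F (x', y) in uniformity. x' = x \<longrightarrow> y \<in> U)"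

instance
proof
  fix x y z :: L2 and a b :: real and U :: "L2 set"
  show "x + y + z = x + (y + z)"
    by transfer (auto simp: L2_rel_def sq_integrable_add add.assoc)
  show "x + y = y + x"
    by transfer (auto simp: L2_rel_def sq_integrable_add add.commute)
  show "0 + x = x"
    by transfer (auto simp: L2_rel_def)
  show "- x + x = 0"
    by transfer (auto simp: L2_rel_def sq_integrable_const)
  show "x - y = x + - y"
    by (rule minus_L2_def)
  show "a *\<^sub>R (x + y) = a *\<^sub>R x + a *\<^sub>R y"
    by transfer (auto simp: L2_rel_def sq_integrable_add sq_integrable_scale distrib_left)
  show "(a + b) *\<^sub>R x = a *\<^sub>R x + b *\<^sub>R x"
    by transfer (auto simp: L2_rel_def sq_integrable_add sq_integrable_scale distrib_right)
  show "a *\<^sub>R b *\<^sub>R x = (a * b) *\<^sub>R x"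
    by transfer (auto simp: L2_rel_def sq_integrable_scale mult.assoc)
  show "1 *\<^sub>R x = x"
    by transfer (auto simp: L2_rel_def)
  show "sgn x = inverse (norm x) *\<^sub>R x"
    by (rule sgn_L2_def)
  show "dist x y = norm (x - y)"
    by (rule dist_L2_def)
  show "uniformity = (INF e\<in>{0<..}. principal {(x::L2, y). dist x y < e})"
    by (rule uniformity_L2_def)
  show "open U \<longleftrightarrow> (\<forall>x\<in>U. \<forall>\<^sub>F (x', y) in uniformity. x' = x \<longrightarrow> y \<in> U)"
    by (rule open_L2_def)
  show "x \<bullet> y = y \<bullet> x"
    by transfer (simp add: mult.commute)
  show "(x + y) \<bullet> z = x \<bullet> z + y \<bullet> z"
    by transfer (auto simp: L2_rel_def sq_integrable_mult distrib_right)
  show "a *\<^sub>R x \<bullet> y = a * (x \<bullet> y)"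
    by transfer (auto simp: L2_rel_def mult.assoc)
  show "0 \<le> x \<bullet> x"
    by transfer simp
  show "x \<bullet> x = 0 \<longleftrightarrow> x = 0"
  proof transfer
    fix f assume "L2_rel f f"
    then have f: "sq_integrable f" by (simp add: L2_rel_def)
    have "(LINT t|unit_measure. f t * f t) = 0 \<longleftrightarrow> (AE t in unit_measure. f t * f t = 0)"
      using sq_integrable_mult[OF f f] by (intro integral_nonneg_eq_0_iff_AE) auto
    then show "(LINT t|unit_measure. f t * f t) = 0 \<longleftrightarrow> L2_rel f (\<lambda>_. 0)"
      using f by (simp add: L2_rel_def sq_integrable_const)
  qed
  show "norm x = sqrt (x \<bullet> x)"
    by (rule norm_L2_def)
qed

end

lemma L2_rel_refl: "L2_rel f f \<longleftrightarrow> sq_integrable f"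
  by (auto simp: L2_rel_def)

lemma sq_integrable_diff:
  "sq_integrable f \<Longrightarrow> sq_integrable g \<Longrightarrow> sq_integrable (\<lambda>t. f t - g t)"
  using sq_integrable_add[OF _ sq_integrable_scale[of g "-1"], of f] by simp

lemma dist_abs_L2:
  assumes "sq_integrable f" "sq_integrable g"
  shows "ennreal ((dist (abs_L2 f) (abs_L2 g))\<^sup>2) = (\<integral>\<^sup>+t. ennreal ((f t - g t)\<^sup>2) \<partial>unit_measure)"
proof -
  note d = sq_integrable_diff[OF assms]
  have "abs_L2 f - abs_L2 g = abs_L2 (\<lambda>t. f t - g t)"
    using assms by (simp add: minus_L2_def uminus_L2.abs_eq plus_L2.abs_eq L2_rel_refl
        sq_integrable_scale[of g "-1", simplified])
  then have "(dist (abs_L2 f) (abs_L2 g))\<^sup>2 = (LINT t|unit_measure. (f t - g t)\<^sup>2)"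
    using d unfolding dist_norm power2_norm_eq_inner
    by (simp add: inner_L2.abs_eq L2_rel_refl power2_eq_square)
  then show ?thesis
    using d by (simp add: nn_integral_eq_integral sq_integrable_def)
qed

lemma abs_L2_cases:
  obtains f where "sq_integrable f" "x = abs_L2 f"
  using Quotient3_abs_rep[OF Quotient3_L2] Quotient3_rep_reflp[OF Quotient3_L2]
  by (metis L2_rel_refl)

instance L2 :: complete_space
proof
  fix X :: "nat \<Rightarrow> L2"
  assume X: "Cauchy X"
  have "\<forall>n. \<exists>N. \<forall>i\<ge>N. \<forall>j\<ge>N. dist (X i) (X j) < (1/2) ^ n"
    using X by (simp add: Cauchy_def)
  then obtain N where N: "dist (X i) (X j) < (1/2) ^ n" if "i \<ge> N n" "j \<ge> N n" for n i j
    by metis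
  define r where "r n = (\<Sum>k\<le>n. N k) + n" for n
  have r: "strict_mono r"
    by (auto simp: strict_mono_Suc_iff r_def)
  have rN: "N n \<le> r m" if "n \<le> m" for n m
  proof -
    have "N n \<le> (\<Sum>k\<le>m. N k)"
      using that by (intro member_le_sum) auto
    then show ?thesis by (simp add: r_def)
  qed
  have "\<forall>n. \<exists>f. sq_integrable f \<and> X (r n) = abs_L2 f"
    using abs_L2_cases by metis
  then obtain f where f: "sq_integrable (f n)" and Xf: "X (r n) = abs_L2 (f n)" for n
    by metis
  have f_meas [measurable]: "f n \<in> borel_measurable unit_measure" for n
    using f by (simp add: sq_integrable_def)
  have bound: "(\<integral>\<^sup>+t. ennreal ((f m t - f n t)\<^sup>2) \<partial>unit_measure) \<le> ennreal (((1/2) ^ n)\<^sup>2)"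
    if "n \<le> m" for n m
  proof -
    have "dist (X (r m)) (X (r n)) \<le> (1/2) ^ n"
      using N[of n "r m" "r n"] rN that by (simp add: less_imp_le)
    then have "ennreal ((dist (X (r m)) (X (r n)))\<^sup>2) \<le> ennreal (((1/2) ^ n)\<^sup>2)"
      by (intro ennreal_leI power_mono) auto
    then show ?thesis by (simp add: Xf dist_abs_L2 f)
  qed
  have bound1: "(\<integral>\<^sup>+t. ennreal \<bar>f (Suc n) t - f n t\<bar> \<partial>unit_measure) \<le> ennreal (2 * (1/2) ^ n)" for n
  proof -
    define e :: real where "e = (1/2) ^ n"
    have e: "e > 0" by (simp add: e_def)
    have "\<bar>u\<bar> \<le> e + inverse e * u\<^sup>2" for u :: real
    proof -
      have "2 * \<bar>u\<bar> * e \<le> \<bar>u\<bar>\<^sup>2 + e\<^sup>2"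
        by (rule sum_squares_bound)
      moreover have "0 \<le> \<bar>u\<bar> * e" "0 \<le> u\<^sup>2" using e by auto
      ultimately have "\<bar>u\<bar> * e \<le> e\<^sup>2 + u\<^sup>2" by (simp add: mult.assoc)
      then show ?thesis using e by (simp add: field_simps power2_eq_square)
    qed
    then have "(\<integral>\<^sup>+t. ennreal \<bar>f (Suc n) t - f n t\<bar> \<partial>unit_measure)
        \<le> (\<integral>\<^sup>+t. ennreal e + ennreal (inverse e) * ennreal ((f (Suc n) t - f n t)\<^sup>2) \<partial>unit_measure)"
      using e by (intro nn_integral_mono)
        (simp add: ennreal_mult'[symmetric] ennreal_plus[symmetric] del: ennreal_plus)
    also have "\<dots> = ennreal e + ennreal (inverse e) * (\<integral>\<^sup>+t. ennreal ((f (Suc n) t - f n t)\<^sup>2) \<partial>unit_measure)"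
      using emeasure_unit by (simp add: nn_integral_add nn_integral_cmult)
    also have "\<dots> \<le> ennreal e + ennreal (inverse e) * ennreal (e\<^sup>2)"
      unfolding e_def by (intro add_left_mono mult_left_mono bound) auto
    also have "\<dots> = ennreal (2 * e)"
      using e by (simp add: ennreal_mult'[symmetric] ennreal_plus[symmetric] power2_eq_square del: ennreal_plus)
    finally show ?thesis by (simp add: e_def)
  qed
  have "(\<integral>\<^sup>+t. (\<Sum>n. ennreal \<bar>f (Suc n) t - f n t\<bar>) \<partial>unit_measure)
      = (\<Sum>n. \<integral>\<^sup>+t. ennreal \<bar>f (Suc n) t - f n t\<bar> \<partial>unit_measure)"
    by (rule nn_integral_suminf) measurable
  also have "\<dots> \<le> (\<Sum>n. ennreal (2 * (1/2) ^ n))"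
    by (intro suminf_le bound1) auto
  also have "\<dots> = ennreal (2 * (1 / (1 - 1/2)))"
  proof (rule suminf_ennreal_eq)
    show "(\<lambda>n. 2 * (1/2) ^ n) sums (2 * (1 / (1 - 1/2 :: real)))"
      by (rule sums_mult[OF geometric_sums]) simp
  qed simp
  also have "\<dots> < \<infinity>" by simp
  finally have "AE t in unit_measure. (\<Sum>n. ennreal \<bar>f (Suc n) t - f n t\<bar>) \<noteq> \<infinity>"
    by (intro nn_integral_PInf_AE) auto
  then have conv: "AE t in unit_measure. convergent (\<lambda>n. f n t)"
  proof eventually_elim
    case (elim t)
    then have "summable (\<lambda>n. \<bar>f (Suc n) t - f n t\<bar>)"
      by (intro summable_suminf_not_top) auto
    then have "summable (\<lambda>n. f (Suc n) t - f n t)"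
      by (rule summable_rabs_cancel)
    moreover have "(\<Sum>k<n. f (Suc k) t - f k t) = f n t - f 0 t" for n
      by (rule sum_lessThan_telescope)
    ultimately have "convergent (\<lambda>n. f n t - f 0 t)"
      by (simp only: summable_iff_convergent)
    then have "convergent (\<lambda>n. f n t - f 0 t + f 0 t)"
      by (intro convergent_add convergent_const)
    then show ?case by simp
  qed
  define F where "F t = lim (\<lambda>n. f n t)" for t
  have F_meas [measurable]: "F \<in> borel_measurable unit_measure"
    unfolding F_def by (rule borel_measurable_lim_metric) (rule f_meas)
  have F_bound: "(\<integral>\<^sup>+t. ennreal ((F t - f n t)\<^sup>2) \<partial>unit_measure) \<le> ennreal (((1/2) ^ n)\<^sup>2)" for n
  proof -
    have "AE t in unit_measure. ennreal ((F t - f n t)\<^sup>2) = liminf (\<lambda>m. ennreal ((f m t - f n t)\<^sup>2))"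
      using conv
    proof eventually_elim
      case (elim t)
      then have "(\<lambda>m. f m t) \<longlonglongrightarrow> F t"
        by (simp add: F_def convergent_LIMSEQ_iff)
      then have "(\<lambda>m. ennreal ((f m t - f n t)\<^sup>2)) \<longlonglongrightarrow> ennreal ((F t - f n t)\<^sup>2)"
        by (intro tendsto_ennrealI tendsto_power tendsto_diff tendsto_const)
      then show ?case
        by (rule lim_imp_Liminf[OF sequentially_bot, symmetric])
    qed
    then have "(\<integral>\<^sup>+t. ennreal ((F t - f n t)\<^sup>2) \<partial>unit_measure)
        = (\<integral>\<^sup>+t. liminf (\<lambda>m. ennreal ((f m t - f n t)\<^sup>2)) \<partial>unit_measure)"
      by (rule nn_integral_cong_AE)
    also have "\<dots> \<le> liminf (\<lambda>m. \<integral>\<^sup>+t. ennreal ((f m t - f n t)\<^sup>2) \<partial>unit_measure)"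
      by (rule nn_integral_liminf) measurable
    also have "\<dots> \<le> limsup (\<lambda>m. \<integral>\<^sup>+t. ennreal ((f m t - f n t)\<^sup>2) \<partial>unit_measure)"
      by (rule Liminf_le_Limsup) simp
    also have "\<dots> \<le> ennreal (((1/2) ^ n)\<^sup>2)"
      by (rule Limsup_bounded) (rule eventually_sequentiallyI, rule bound)
    finally show ?thesis .
  qed
  have "sq_integrable (\<lambda>t. F t - f 0 t)"
  proof -
    have "(\<integral>\<^sup>+t. ennreal ((F t - f 0 t)\<^sup>2) \<partial>unit_measure) < \<infinity>"
      using F_bound[of 0] by (rule le_less_trans) simp
    then show ?thesis by (simp add: sq_integrable_def integrable_iff_bounded)
  qed
  from sq_integrable_add[OF this f[of 0]] have F: "sq_integrable F" by simp
  have "dist (X (r n)) (abs_L2 F) \<le> (1/2) ^ n" for n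
  proof -
    have "ennreal ((dist (abs_L2 F) (X (r n)))\<^sup>2) \<le> ennreal (((1/2) ^ n)\<^sup>2)"
      using F_bound[of n] by (simp add: Xf dist_abs_L2 F f)
    then have "(dist (abs_L2 F) (X (r n)))\<^sup>2 \<le> ((1/2) ^ n)\<^sup>2"
      by (simp only: ennreal_le_iff zero_le_power2)
    then show ?thesis
      unfolding dist_commute[of _ "abs_L2 F"] by (rule power2_le_imp_le) simp
  qed
  then have "(\<lambda>n. dist (X (r n)) (abs_L2 F)) \<longlonglongrightarrow> 0"
    using LIMSEQ_power_zero[of "1/2 :: real"]
    by (intro tendsto_sandwich[of "\<lambda>_. 0" "\<lambda>n. dist (X (r n)) (abs_L2 F)" sequentially "\<lambda>n. (1/2) ^ n"])
      simp_all
  then have "(X \<circ> r) \<longlonglongrightarrow> abs_L2 F"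
    unfolding o_def by (subst tendsto_dist_iff)
  from Cauchy_converges_subseq[OF X r this] show "convergent X"
    by (auto simp: convergent_def)
qed

section \<open>The integration operator and the Cesaro operator\<close>

lemma nn_integral_unit_measure:
  "(\<integral>\<^sup>+t. f t \<partial>unit_measure) = (\<integral>\<^sup>+t. f t * indicator {0<..<1} t \<partial>lborel)"
  by (simp add: nn_integral_restrict_space nn_integral_completion)

lemma unit_measure_borel: "f \<in> borel_measurable borel \<Longrightarrow> f \<in> borel_measurable unit_measure"
  by (intro measurable_restrict_space1 measurable_completion) simp

lemma measurable_ident_unit: "(\<lambda>x. x) \<in> borel_measurable unit_measure"
  by (rule unit_measure_borel) simp

lemma primitive_measurable:
  fixes f :: "real \<Rightarrow> real"
  assumes "f \<in> borel_measurable unit_measure"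
  shows "(\<lambda>s. LINT t:{0<..s}|unit_measure. f t) \<in> borel_measurable unit_measure"
proof -
  interpret finite_measure unit_measure by (rule finite_measure_unit)
  note [measurable] = assms measurable_ident_unit
  have "(\<lambda>(s, t). (if 0 < t \<and> t \<le> s then 1 else 0) *\<^sub>R f t)
      \<in> borel_measurable (unit_measure \<Otimes>\<^sub>M unit_measure)"
    by measurable
  then have "(\<lambda>s. LINT t|unit_measure. (if 0 < t \<and> t \<le> s then 1 else 0) *\<^sub>R f t)
      \<in> borel_measurable unit_measure"
    by (rule sigma_finite_measure.borel_measurable_lebesgue_integral[OF sigma_finite_measure_axioms, of "\<lambda>s t. (if 0 < t \<and> t \<le> s then 1 else 0) *\<^sub>R f t"])
  then show ?thesis
    by (simp add: set_lebesgue_integral_def indicator_def of_bool_def)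
qed

lemma primitive_cong:
  assumes "L2_rel f g"
  shows "(LINT t:{0<..s}|unit_measure. f t) = (LINT t:{0<..s}|unit_measure. g t)"
proof -
  have [measurable]: "(indicator {0<..s} :: real \<Rightarrow> real) \<in> borel_measurable unit_measure"
    by (rule unit_measure_borel) measurable
  show ?thesis
    unfolding set_lebesgue_integral_def
    using assms
    by (intro integral_cong_AE) (auto simp: L2_rel_def sq_integrable_def)
qed

lemma Hardy_pointwise:
  assumes "sq_integrable f" "0 < s"
  shows "ennreal ((1 / s * (LINT t:{0<..s}|unit_measure. f t))\<^sup>2)
      \<le> (\<integral>\<^sup>+t. ennreal (2 * s powr (-3/2)) * indicator {..s} t * ennreal (t powr (1/2) * (f t)\<^sup>2) \<partial>unit_measure)"
proof -
  define I where "I = (LINT t:{0<..s}|unit_measure. f t)"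
  have f [measurable]: "f \<in> borel_measurable unit_measure"
    using assms(1) by (simp add: sq_integrable_def)
  have [measurable]:
    "(\<lambda>t. t powr c) \<in> borel_measurable unit_measure"
    "(indicator {0<..s} :: real \<Rightarrow> real) \<in> borel_measurable unit_measure"
    "(indicator {..s} :: real \<Rightarrow> real) \<in> borel_measurable unit_measure"
    "(indicator {..s} :: real \<Rightarrow> ennreal) \<in> borel_measurable unit_measure" for c s :: real
    by (rule unit_measure_borel, measurable)+
  have "ennreal \<bar>I\<bar> \<le> (\<integral>\<^sup>+t. ennreal (norm (indicator {0<..s} t *\<^sub>R f t)) \<partial>unit_measure)"
    unfolding I_def set_lebesgue_integral_def real_norm_def[symmetric]
  proof (rule integral_norm_bound_ennreal)
    have "(\<lambda>t. indicator {0<..s} t *\<^sub>R f t) \<in> borel_measurable unit_measure"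
      by measurable
    then show "integrable unit_measure (\<lambda>t. indicator {0<..s} t *\<^sub>R f t)"
      by (rule Bochner_Integration.integrable_bound[OF sq_integrable_integrable[OF assms(1)]])
        (simp_all add: indicator_def)
  qed
  also have "\<dots> = (\<integral>\<^sup>+t. ennreal (indicator {..s} t * t powr (-1/4)) * ennreal (t powr (1/4) * \<bar>f t\<bar> * indicator {..s} t) \<partial>unit_measure)"
    by (intro nn_integral_cong) (auto simp: indicator_def ennreal_mult'[symmetric] powr_add[symmetric] mult.assoc[symmetric])
  finally have "(ennreal \<bar>I\<bar>)\<^sup>2 \<le> (\<dots>)\<^sup>2"
    by (rule power_mono) simp
  also have "\<dots> \<le> (\<integral>\<^sup>+t. (ennreal (indicator {..s} t * t powr (-1/4)))\<^sup>2 \<partial>unit_measure) * (\<integral>\<^sup>+t. (ennreal (t powr (1/4) * \<bar>f t\<bar> * indicator {..s} t))\<^sup>2 \<partial>unit_measure)"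
    by (rule Cauchy_Schwarz_nn_integral) measurable
  also have "(\<integral>\<^sup>+t. (ennreal (indicator {..s} t * t powr (-1/4)))\<^sup>2 \<partial>unit_measure)
       \<le> (\<integral>\<^sup>+t. ennreal (indicator {0..s} t * t powr (-1/2)) \<partial>lborel)"
    unfolding nn_integral_unit_measure
    by (intro nn_integral_mono)
      (auto simp: indicator_def ennreal_mult'[symmetric] power2_eq_square powr_add[symmetric])
  also have "\<dots> = ennreal (2 * s powr (1/2))"
    using nn_integral_has_integral_lebesgue[OF _ has_integral_powr_from_0[of "-1/2" s]] assms(2) by simp
  also have "(\<integral>\<^sup>+t. (ennreal (t powr (1/4) * \<bar>f t\<bar> * indicator {..s} t))\<^sup>2 \<partial>unit_measure)
     = (\<integral>\<^sup>+t. indicator {..s} t * ennreal (t powr (1/2) * (f t)\<^sup>2) \<partial>unit_measure)"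
    by (intro nn_integral_cong)
      (auto simp: indicator_def ennreal_power power_mult_distrib powr_add[symmetric] power2_eq_square[of "_ powr _"])
  finally have "ennreal (I\<^sup>2) \<le> ennreal (2 * s powr (1/2)) * (\<integral>\<^sup>+t. indicator {..s} t * ennreal (t powr (1/2) * (f t)\<^sup>2) \<partial>unit_measure)"
    by (simp add: ennreal_power mult_right_mono)
  then have "ennreal (1 / s\<^sup>2) * ennreal (I\<^sup>2) \<le> ennreal (1 / s\<^sup>2) * (ennreal (2 * s powr (1/2)) * (\<integral>\<^sup>+t. indicator {..s} t * ennreal (t powr (1/2) * (f t)\<^sup>2) \<partial>unit_measure))"
    by (rule mult_left_mono) simp
  also have "\<dots> = ennreal (2 * s powr (-3/2)) * (\<integral>\<^sup>+t. indicator {..s} t * ennreal (t powr (1/2) * (f t)\<^sup>2) \<partial>unit_measure)"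
  proof -
    have "1 / s\<^sup>2 * (2 * s powr (1/2)) = 2 * (s powr (-2) * s powr (1/2))"
      using assms(2) by (simp add: powr_minus field_simps)
    also have "\<dots> = 2 * s powr (-3/2)"
      by (simp add: powr_add[symmetric])
    finally show ?thesis
      by (simp add: mult.assoc[symmetric] ennreal_mult'[symmetric])
  qed
  finally show ?thesis
    by (simp add: I_def ennreal_mult'[symmetric] power_divide nn_integral_cmult[symmetric] mult.assoc)
qed

lemma Hardy_inequality:
  assumes "sq_integrable f"
  shows "(\<integral>\<^sup>+s. ennreal ((1 / s * (LINT t:{0<..s}|unit_measure. f t))\<^sup>2) \<partial>unit_measure)
      \<le> 4 * (\<integral>\<^sup>+t. ennreal ((f t)\<^sup>2) \<partial>unit_measure)"
proof -
  interpret finite_measure unit_measure by (rule finite_measure_unit)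
  interpret pair_sigma_finite unit_measure unit_measure ..
  have f [measurable]: "f \<in> borel_measurable unit_measure"
    using assms(1) by (simp add: sq_integrable_def)
  have [measurable]:
    "(\<lambda>t. t powr c) \<in> borel_measurable unit_measure"
    "(indicator {0<..s} :: real \<Rightarrow> real) \<in> borel_measurable unit_measure"
    "(indicator {..s} :: real \<Rightarrow> real) \<in> borel_measurable unit_measure"
    "(indicator {..s} :: real \<Rightarrow> ennreal) \<in> borel_measurable unit_measure" for c s :: real
    by (rule unit_measure_borel, measurable)+
  note [measurable] = measurable_ident_unit
  let ?h = "\<lambda>s t. ennreal (2 * s powr (-3/2)) * (if t \<le> s then 1 else 0) * ennreal (t powr (1/2) * (f t)\<^sup>2)"
  have "(\<integral>\<^sup>+s. ennreal ((1 / s * (LINT t:{0<..s}|unit_measure. f t))\<^sup>2) \<partial>unit_measure)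
     \<le> (\<integral>\<^sup>+s. (\<integral>\<^sup>+t. ?h s t \<partial>unit_measure) \<partial>unit_measure)"
    using Hardy_pointwise[OF assms]
    by (intro nn_integral_mono) (simp add: indicator_def of_bool_def)
  also have "\<dots> = (\<integral>\<^sup>+t. (\<integral>\<^sup>+s. ?h s t \<partial>unit_measure) \<partial>unit_measure)"
    by (rule Fubini'[symmetric]) measurable
  also have "\<dots> \<le> (\<integral>\<^sup>+t. 4 * ennreal ((f t)\<^sup>2) \<partial>unit_measure)"
  proof (rule nn_integral_mono)
    fix t assume "t \<in> space unit_measure"
    then have t: "0 < t" "t < 1" by auto
    have "(\<integral>\<^sup>+s. ?h s t \<partial>unit_measure)
        = (\<integral>\<^sup>+s. ennreal (2 * s powr (-3/2)) * (if t \<le> s then 1 else 0) \<partial>unit_measure) * ennreal (t powr (1/2) * (f t)\<^sup>2)"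
      by (rule nn_integral_multc) measurable
    also have "(\<integral>\<^sup>+s. ennreal (2 * s powr (-3/2)) * (if t \<le> s then 1 else 0) \<partial>unit_measure)
        \<le> (\<integral>\<^sup>+s. ennreal (2 * s powr (-3/2)) * indicator {t..1} s \<partial>lborel)"
      unfolding nn_integral_unit_measure
      by (intro nn_integral_mono) (auto simp: indicator_def)
    also have "\<dots> = ennreal (- 4 * 1 powr (-1/2) - (- 4 * t powr (-1/2)))"
    proof (rule nn_integral_FTC_Icc)
      show "((\<lambda>s. - 4 * s powr (-1/2)) has_real_derivative 2 * s powr (-3/2)) (at s)" if "s \<in> {t..1}" for s
      proof -
        have "0 < s" using that t by simp
        from DERIV_cmult[OF has_real_derivative_powr[OF this, of "-1/2"], of "- 4"]
        show ?thesis by simp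
      qed
    qed (use t in auto)
    also have "\<dots> \<le> ennreal (4 * t powr (-1/2))"
      by (intro ennreal_leI) simp
    also have "ennreal (4 * t powr (-1/2)) * ennreal (t powr (1/2) * (f t)\<^sup>2) = ennreal (4 * (f t)\<^sup>2)"
      using t by (simp add: ennreal_mult'[symmetric] powr_minus)
    finally show "(\<integral>\<^sup>+s. ?h s t \<partial>unit_measure) \<le> 4 * ennreal ((f t)\<^sup>2)"
      by (simp add: ennreal_mult' mult_right_mono)
  qed
  also have "\<dots> = 4 * (\<integral>\<^sup>+t. ennreal ((f t)\<^sup>2) \<partial>unit_measure)"
    by (rule nn_integral_cmult) measurable
  finally show ?thesis .
qed

lemma sq_integrable_Cesaro:
  assumes "sq_integrable f"
  shows "sq_integrable (\<lambda>s. 1 / s * (LINT t:{0<..s}|unit_measure. f t))"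
proof -
  note [measurable] = measurable_ident_unit
    primitive_measurable[OF sq_integrable_measurable[OF assms]]
  have "(\<integral>\<^sup>+t. ennreal ((f t)\<^sup>2) \<partial>unit_measure) < \<infinity>"
    using assms by (auto simp: sq_integrable_def integrable_iff_bounded)
  then have "4 * (\<integral>\<^sup>+t. ennreal ((f t)\<^sup>2) \<partial>unit_measure) < \<infinity>"
    by (simp add: ennreal_mult_less_top)
  with Hardy_inequality[OF assms]
  have "(\<integral>\<^sup>+s. ennreal ((1 / s * (LINT t:{0<..s}|unit_measure. f t))\<^sup>2) \<partial>unit_measure) < \<infinity>"
    by (rule le_less_trans)
  then show ?thesis
    by (auto simp: sq_integrable_def integrable_iff_bounded)
qed

lemma sq_integrable_primitive:
  assumes "sq_integrable f"
  shows "sq_integrable (\<lambda>s. LINT t:{0<..s}|unit_measure. f t)"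
proof -
  note C = sq_integrable_Cesaro[OF assms]
  have m: "(\<lambda>s. LINT t:{0<..s}|unit_measure. f t) \<in> borel_measurable unit_measure"
    using primitive_measurable[OF sq_integrable_measurable[OF assms]] .
  have "integrable unit_measure (\<lambda>s. (LINT t:{0<..s}|unit_measure. f t)\<^sup>2)"
  proof (rule Bochner_Integration.integrable_bound)
    show "integrable unit_measure (\<lambda>s. (1 / s * (LINT t:{0<..s}|unit_measure. f t))\<^sup>2)"
      using C by (simp add: sq_integrable_def)
    show "(\<lambda>s. (LINT t:{0<..s}|unit_measure. f t)\<^sup>2) \<in> borel_measurable unit_measure"
      using m by simp
    have "a\<^sup>2 \<le> (1 / s * a)\<^sup>2" if "0 < s" "s < 1" for a s :: real
      using that by (simp add: power_divide field_simps mult_left_le power_le_one)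
    then show "AE s in unit_measure. norm ((LINT t:{0<..s}|unit_measure. f t)\<^sup>2)
        \<le> norm ((1 / s * (LINT t:{0<..s}|unit_measure. f t))\<^sup>2)"
      by (intro AE_I2) simp
  qed
  with m show ?thesis by (simp add: sq_integrable_def)
qed

lift_definition integration_op :: "L2 \<Rightarrow> L2"
  is "\<lambda>x s. LINT t:{0<..s}|unit_measure. x t"
  using primitive_cong sq_integrable_primitive by (auto simp: L2_rel_def)

lift_definition Cesaro_op :: "L2 \<Rightarrow> L2"
  is "\<lambda>x s. 1 / s * (LINT t:{0<..s}|unit_measure. x t)"
  using primitive_cong sq_integrable_Cesaro by (auto simp: L2_rel_def)


section \<open>Compact operators, singular values and the degree of ill-posedness\<close>

definition compact_operator ::
    "('a::real_normed_vector \<Rightarrow> 'b::real_normed_vector) \<Rightarrow> bool" where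
  "compact_operator T \<longleftrightarrow>
     bounded_linear T \<and> (\<forall>S. bounded S \<longrightarrow> compact (closure (T ` S)))"

text \<open>The number \<open>s > 0\<close> is a singular value of \<open>T\<close> iff \<open>s\<^sup>2\<close> is an eigenvalue of
  \<open>T\<^sup>* T\<close>, i.e. iff this space is nontrivial; its dimension is the multiplicity of \<open>s\<close>.\<close>

definition singular_space ::
    "('a::{real_inner, complete_space} \<Rightarrow> 'b::{real_inner, complete_space}) \<Rightarrow> real \<Rightarrow> 'a set" where
  "singular_space T s = {x. adjoint T (T x) = s\<^sup>2 *\<^sub>R x}"

text \<open>\<open>\<sigma> 1 \<ge> \<sigma> 2 \<ge> \<dots>\<close> enumerates the singular values of \<open>T\<close>, each repeated
  according to its multiplicity.  The entry \<open>\<sigma> 0\<close> is irrelevant.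
  Such a sequence exists for compact operators of infinite rank (in particular for injective ones
  on infinite-dimensional spaces) and is then unique, see \<open>singular_value_eq\<close>;
  for other operators \<open>singular_value\<close> is unspecified.\<close>

definition singular_value_sequence ::
    "('a::{real_inner, complete_space} \<Rightarrow> 'b::{real_inner, complete_space}) \<Rightarrow> (nat \<Rightarrow> real) \<Rightarrow> bool" where
  "singular_value_sequence T \<sigma> \<longleftrightarrow>
     (\<forall>n\<ge>1. 0 < \<sigma> n) \<and>
     (\<forall>m\<ge>1. \<forall>n\<ge>m. \<sigma> n \<le> \<sigma> m) \<and>
     \<sigma> \<longlonglongrightarrow> 0 \<and>
     (\<forall>s>0. \<exists>B. finite B \<and> independent B \<and> span B = singular_space T s \<and>
              card B = card {n. 1 \<le> n \<and> \<sigma> n = s})"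

definition singular_value ::
    "('a::{real_inner, complete_space} \<Rightarrow> 'b::{real_inner, complete_space}) \<Rightarrow> nat \<Rightarrow> real" where
  "singular_value T n = (THE s. \<exists>\<sigma>. singular_value_sequence T \<sigma> \<and> s = \<sigma> n)"

lemma singular_value_sequence_unique:
  assumes "singular_value_sequence T \<sigma>" "singular_value_sequence T \<tau>" "1 \<le> n"
  shows "\<sigma> n = \<tau> n"
proof -
  have not_less: "\<not> \<tau> n < \<sigma> n"
    if \<sigma>: "singular_value_sequence T \<sigma>" and \<tau>: "singular_value_sequence T \<tau>"
      and n: "1 \<le> n" and eq: "\<forall>k. 1 \<le> k \<and> k < n \<longrightarrow> \<sigma> k = \<tau> k" for \<sigma> \<tau> n
  proof
    assume less: "\<tau> n < \<sigma> n"
    define s where "s = \<sigma> n"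
    have s: "0 < s" using \<sigma> n by (simp add: s_def singular_value_sequence_def)
    have card_eq: "card {k. 1 \<le> k \<and> \<rho> k = s} = dim (singular_space T s)"
      if "singular_value_sequence T \<rho>" for \<rho>
    proof -
      from that s obtain B where "independent B" "span B = singular_space T s"
          "card B = card {k. 1 \<le> k \<and> \<rho> k = s}"
        unfolding singular_value_sequence_def by auto
      then show ?thesis using dim_span_eq_card_independent[of B] by simp
    qed
    have "eventually (\<lambda>k. \<sigma> k < s) sequentially"
      using \<sigma> s by (intro order_tendstoD) (auto simp: singular_value_sequence_def)
    then obtain K where K: "\<And>k. k \<ge> K \<Longrightarrow> \<sigma> k < s"
      by (auto simp: eventually_sequentially)
    have "finite {k. 1 \<le> k \<and> \<sigma> k = s}"
    proof (rule finite_subset)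
      show "{k. 1 \<le> k \<and> \<sigma> k = s} \<subseteq> {..<K}"
        using K by (force simp: not_le[symmetric])
    qed simp
    moreover have "{k. 1 \<le> k \<and> \<tau> k = s} \<subset> {k. 1 \<le> k \<and> \<sigma> k = s}"
    proof -
      have "k < n" if "1 \<le> k" "\<tau> k = s" for k
      proof (rule ccontr)
        assume "\<not> k < n"
        then have "\<tau> k \<le> \<tau> n" using \<tau> n by (simp add: singular_value_sequence_def)
        with less that show False by (simp add: s_def)
      qed
      then show ?thesis using eq n less by (auto simp: s_def)
    qed
    ultimately have "card {k. 1 \<le> k \<and> \<tau> k = s} < card {k. 1 \<le> k \<and> \<sigma> k = s}"
      by (rule psubset_card_mono)
    then show False using card_eq \<sigma> \<tau> by simp
  qed
  show ?thesis
    using assms(3)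
  proof (induction n rule: less_induct)
    case (less n)
    then have "\<forall>k. 1 \<le> k \<and> k < n \<longrightarrow> \<sigma> k = \<tau> k" by auto
    with not_less[OF assms(1,2) less.prems] not_less[OF assms(2,1) less.prems]
    show ?case by auto
  qed
qed

lemma singular_value_eq:
  assumes "singular_value_sequence T \<sigma>" "1 \<le> n"
  shows "singular_value T n = \<sigma> n"
  unfolding singular_value_def
proof (rule the_equality)
  show "\<exists>\<sigma>'. singular_value_sequence T \<sigma>' \<and> \<sigma> n = \<sigma>' n"
    using assms(1) by (intro exI[of _ \<sigma>]) simp
  show "s = \<sigma> n" if "\<exists>\<sigma>'. singular_value_sequence T \<sigma>' \<and> s = \<sigma>' n" for s
    using that singular_value_sequence_unique[OF assms(1) _ assms(2)] by auto
qed

definition asymp_comparable :: "(nat \<Rightarrow> real) \<Rightarrow> (nat \<Rightarrow> real) \<Rightarrow> bool"  (infix "\<asymp>" 50) where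
  "a \<asymp> b \<longleftrightarrow>
     (\<exists>c C. 0 < c \<and> c \<le> C \<and> (\<forall>\<^sub>F n in sequentially. c * b n \<le> a n \<and> a n \<le> C * b n))"

definition ill_posedness_lower ::
    "('a::{real_inner, complete_space} \<Rightarrow> 'b::{real_inner, complete_space}) \<Rightarrow> ereal" where
  "ill_posedness_lower T = liminf (\<lambda>n. ereal (- ln (singular_value T n) / ln (real n)))"

definition ill_posedness_upper ::
    "('a::{real_inner, complete_space} \<Rightarrow> 'b::{real_inner, complete_space}) \<Rightarrow> ereal" where
  "ill_posedness_upper T = limsup (\<lambda>n. ereal (- ln (singular_value T n) / ln (real n)))"

definition ill_posed_of_degree ::
    "('a::{real_inner, complete_space} \<Rightarrow> 'b::{real_inner, complete_space}) \<Rightarrow> real \<Rightarrow> bool" where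
  "ill_posed_of_degree T \<mu> \<longleftrightarrow>
     0 < \<mu> \<and> ill_posedness_lower T = ereal \<mu> \<and> ill_posedness_upper T = ereal \<mu>"

end

theory Submission
  imports Defs
begin

text \<open>
  Singular values are estimated by their extremal characterization. Upper bound: requiring
  \<open>Jx\<close> and \<open>J\<^sup>2x\<close> to vanish at the nodes \<open>(k/n)\<^sup>2\<close>, which is \<open>2n\<close> linear conditions, makes the estimate
  local, and the Cauchy-Schwarz inequality on each cell gives \<open>\<parallel>Ax\<parallel> \<le> 9 n\<^sup>-\<^sup>2 \<parallel>x\<parallel>\<close>. Lower bound: the weight
  \<open>1/s\<close> is at least 1, so \<open>\<parallel>Ax\<parallel> \<ge> \<parallel>J\<^sup>2x\<parallel>\<close>, and on the span of \<open>cos (2\<pi>kt)\<close>, \<open>1 \<le> k \<le> n\<close>, the operator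
  \<open>J\<^sup>2\<close> is \<open>-(2\<pi>k)\<^sup>-\<^sup>2\<close> up to a constant function, which is orthogonal to all these cosines.
\<close>

section \<open>Adjoints and compact operators\<close>

text \<open>The Cesaro operator is bounded but not compact, so multiplying its norm with the
  singular values of J yields only the order 1/n for the composition. The composition is therefore
  treated as one operator, J^2 followed by multiplication with 1/s, so that both integrations count.
  The obstacle is the weight near 0: on a cell [a, a + d] the local estimate costs d^2 / a, which on
  uniform cells of width 1/n is still 1/n next to the origin. Cells with d of the order sqrt a / n
  bring it down to 1/n^2 everywhere. \<open>singular_value\<close> is a definite description and
  says something only once a singular value sequence has been exhibited. Hence the spectral theory
  of T* T is developed by a greedy construction, after the Riesz representation has given
  \<open>adjoint\<close> its defining property. Both finite-dimensional estimates serve twice: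
  smallness on subspaces of finite codimension also yields compactness, and lower bounds on
  subspaces of every finite dimension also yield infinite rank.\<close>

text \<open>Riesz representation by minimization: if \<open>m\<close> represents the functional,
  then Q x = |x - m|^2 - |m|^2, so \<open>m\<close> is found as the minimizer of
  \<open>Q\<close>.\<close>

lemma bounded_linear_functional_inner:
  fixes \<phi> :: "'a::{real_inner, complete_space} \<Rightarrow> real"
  assumes "bounded_linear \<phi>"
  obtains m where "\<And>x. \<phi> x = m \<bullet> x"
proof -
  interpret \<phi>: bounded_linear \<phi> by fact
  define Q where "Q x = x \<bullet> x - 2 * \<phi> x" for x
  obtain K where K: "\<And>x. norm (\<phi> x) \<le> norm x * K" using \<phi>.bounded by blast
  \<comment> \<open>Completing the square: Q x is at least (|x| - K)^2 - K^2.\<close>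
  have Q_ge: "Q x \<ge> - K\<^sup>2" for x
  proof -
    have "0 \<le> (norm x - K)\<^sup>2" by simp
    then show ?thesis using K[of x] unfolding Q_def power2_norm_eq_inner[symmetric] power2_diff
      by (auto simp: abs_le_iff)
  qed
  then have bdd: "bdd_below (range Q)" by (intro bdd_belowI[of _ "- K\<^sup>2"]) auto
  define I where "I = Inf (range Q)"
  have I_le: "I \<le> Q x" for x unfolding I_def by (intro cInf_lower bdd) auto
  \<comment> \<open>Parallelogram law: \<open>Q\<close> at the midpoint is at least
    \<open>I\<close>. Points with nearly minimal \<open>Q\<close> are therefore close together,
    which makes minimizing sequences Cauchy.\<close>
  have par: "(dist x y)\<^sup>2 \<le> 2 * (Q x - I) + 2 * (Q y - I)" for x y
  proof -
    have "Q ((1/2) *\<^sub>R (x + y)) = (Q x + Q y) / 2 - (dist x y)\<^sup>2 / 4"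
      unfolding Q_def dist_norm power2_norm_eq_inner
      by (simp add: \<phi>.add \<phi>.scaleR inner_add inner_diff inner_commute field_simps)
    with I_le[of "(1/2) *\<^sub>R (x + y)"] show ?thesis by argo
  qed
  have "\<exists>x. Q x < I + inverse (real (Suc n))" for n
  proof -
    have "Inf (range Q) < I + inverse (real (Suc n))" by (simp add: I_def)
    then show ?thesis using cInf_lessD[of "range Q"] by auto
  qed
  then obtain u where u: "\<And>n. Q (u n) < I + inverse (real (Suc n))" by metis
  have "Cauchy u"
  proof (rule metric_CauchyI)
    fix e :: real assume e: "e > 0"
    obtain N where N: "inverse (real (Suc N)) < e\<^sup>2 / 4"
      using reals_Archimedean[of "e\<^sup>2 / 4"] e by auto
    have "dist (u m) (u n) < e" if "m \<ge> N" "n \<ge> N" for m n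
    proof -
      have inv: "inverse (real (Suc k)) \<le> inverse (real (Suc N))" if "k \<ge> N" for k
        using that by (intro le_imp_inverse_le) auto
      have "(dist (u m) (u n))\<^sup>2 < e\<^sup>2"
        using par[of "u m" "u n"] u[of m] u[of n] inv[OF that(1)] inv[OF that(2)] N by argo
      then show ?thesis using e by (intro power_less_imp_less_base[of _ 2 e]) auto
    qed
    then show "\<exists>N. \<forall>m\<ge>N. \<forall>n\<ge>N. dist (u m) (u n) < e" by blast
  qed
  then obtain m where m: "u \<longlonglongrightarrow> m" using Cauchy_convergent_iff convergent_def by blast
  have "(\<lambda>n. Q (u n)) \<longlonglongrightarrow> Q m" unfolding Q_def
    by (intro tendsto_intros m \<phi>.tendsto)
  moreover have "(\<lambda>n. Q (u n)) \<longlonglongrightarrow> I"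
  proof (rule tendsto_sandwich[of "\<lambda>_. I" _ _ "\<lambda>n. I + inverse (real (Suc n))"])
    show "(\<lambda>n. I + inverse (real (Suc n))) \<longlonglongrightarrow> I"
      using tendsto_add[OF tendsto_const LIMSEQ_inverse_real_of_nat, of I] by simp
  qed (use I_le u in \<open>auto intro!: always_eventually less_imp_le simp del: of_nat_Suc\<close>)
  ultimately have "Q m = I" by (rule LIMSEQ_unique)
  have "\<phi> x = m \<bullet> x" for x
  proof (cases "x = 0")
    case False
    define d where "d = m \<bullet> x - \<phi> x"
    \<comment> \<open>The minimizer of the quadratic t^2 (x \<bullet> x) + 2 t d, which is the
      change of \<open>Q\<close> from \<open>m\<close> to m + t x.\<close>
    define t where "t = - d / (x \<bullet> x)"
    have "Q m \<le> Q (m + t *\<^sub>R x)" using I_le \<open>Q m = I\<close> by simp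
    then have "0 \<le> t\<^sup>2 * (x \<bullet> x) + 2 * t * d"
      unfolding Q_def d_def
      by (simp add: \<phi>.add \<phi>.scaleR inner_add inner_commute algebra_simps power2_eq_square)
    also have "\<dots> = - d\<^sup>2 / (x \<bullet> x)"
      using False by (simp add: t_def power2_eq_square field_simps)
    finally have "d\<^sup>2 / (x \<bullet> x) \<le> 0" by simp
    moreover have "0 < x \<bullet> x" using False by simp
    ultimately have "d\<^sup>2 \<le> 0" by (metis divide_pos_pos not_le)
    then show ?thesis by (simp add: d_def)
  qed (simp add: \<phi>.zero)
  then show thesis using that by blast
qed

text \<open>\<open>adjoint\<close> is a Hilbert choice, so its defining equation holds only once
  some adjoint is known to exist; Riesz representation of x \<mapsto> T x \<bullet> y supplies
  one.\<close>

lemma inner_adjoint: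
  fixes T :: "'a::{real_inner, complete_space} \<Rightarrow> 'b::real_inner"
  assumes "bounded_linear T"
  shows "T x \<bullet> y = x \<bullet> adjoint T y"
proof -
  have "\<exists>m. \<forall>x. T x \<bullet> y = m \<bullet> x" for y
    using bounded_linear_functional_inner[OF bounded_linear_inner_left_comp[OF assms, of y]]
    by metis
  then obtain g where "\<And>y x. T x \<bullet> y = g y \<bullet> x" by metis
  then have "\<exists>f'. \<forall>x y. T x \<bullet> y = x \<bullet> f' y"
    by (intro exI[of _ g]) (simp add: inner_commute)
  then show ?thesis unfolding adjoint_def by (rule someI2_ex) simp
qed

lemma bounded_linear_adjoint:
  fixes T :: "'a::{real_inner, complete_space} \<Rightarrow> 'b::real_inner"
  assumes T: "bounded_linear T"
  shows "bounded_linear (adjoint T)"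
proof -
  interpret T: bounded_linear T by fact
  obtain K where K: "K \<ge> 0" "\<And>x. norm (T x) \<le> norm x * K" using T.nonneg_bounded by blast
  note adj = inner_adjoint[OF T, symmetric]
  show ?thesis
  proof (rule bounded_linear_intro[where K = K])
    show "adjoint T (x + y) = adjoint T x + adjoint T y" for x y
      by (subst vector_eq_rdot[symmetric]) (simp add: inner_add_left inner_add_right adj inner_commute[of "adjoint T _"])
    show "adjoint T (r *\<^sub>R x) = r *\<^sub>R adjoint T x" for r x
      by (subst vector_eq_rdot[symmetric]) (simp add: adj inner_commute[of "adjoint T _"])
    show "norm (adjoint T y) \<le> norm y * K" for y
    proof (cases "adjoint T y = 0")
      case False
      have "(norm (adjoint T y))\<^sup>2 = T (adjoint T y) \<bullet> y"
        by (simp add: power2_norm_eq_inner inner_adjoint[OF T])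
      also have "\<dots> \<le> norm (T (adjoint T y)) * norm y" by (rule norm_cauchy_schwarz)
      also have "\<dots> \<le> norm (adjoint T y) * K * norm y" by (intro mult_right_mono K) auto
      finally show ?thesis using False by (simp add: power2_eq_square mult.assoc mult.commute)
    qed (simp add: K)
  qed
qed

lemma inner_span_eq_0:
  fixes x :: "'a::real_inner"
  assumes "\<forall>d\<in>D. d \<bullet> x = 0" "y \<in> span D"
  shows "y \<bullet> x = 0"
  using assms(2) by (induction rule: span_induct_alt) (use assms(1) in \<open>auto simp: inner_add_left\<close>)

section \<open>Orthonormal systems and dimension counting\<close>

definition orthonormal :: "'a::real_inner set \<Rightarrow> bool" where
  "orthonormal D \<longleftrightarrow> (\<forall>d\<in>D. \<forall>d'\<in>D. d \<bullet> d' = (if d = d' then 1 else 0))"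

text \<open>Orthogonality to \<open>F\<close> depends only on its span, so \<open>F\<close> may be
  replaced by an orthonormal set, for which the projection onto the span is an explicit sum.\<close>

lemma orthonormal_spanning_set:
  fixes F :: "'a::real_inner set"
  assumes "finite F"
  obtains D where "finite D" "card D \<le> card F" "span D = span F" "orthonormal D"
proof -
  obtain C where C: "finite C" "card C \<le> card F" "span C = span F" "pairwise orthogonal C"
    using basis_orthogonal[OF assms] by blast
  define D where "D = sgn ` (C - {0})"
  have "card D \<le> card F"
    unfolding D_def using C(1,2) card_image_le[of "C - {0}" sgn] card_mono[of C "C - {0}"] by auto
  moreover have "span D = span F"
  proof -
    have "c \<in> span D" if "c \<in> C" for c
    proof (cases "c = 0")
      case False
      then have "norm c *\<^sub>R sgn c \<in> span D" using that by (intro span_scale span_base) (auto simp: D_def)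
      then show ?thesis using False by (simp add: sgn_div_norm)
    qed (simp add: span_zero)
    moreover have "d \<in> span C" if "d \<in> D" for d
      using that by (auto simp: D_def sgn_div_norm intro: span_scale span_base)
    ultimately have "span D = span C"
      by (intro span_eq[THEN iffD2]) blast
    then show ?thesis using C by simp
  qed
  moreover have "d \<bullet> d' = (if d = d' then 1 else 0)" if "d \<in> D" "d' \<in> D" for d d'
  proof (cases "d = d'")
    case True
    then show ?thesis using that by (auto simp: D_def norm_sgn power2_norm_eq_inner[symmetric] split: if_splits)
  next
    case False
    obtain c c' where c: "c \<in> C" "c' \<in> C" "d = sgn c" "d' = sgn c'"
      using \<open>d \<in> D\<close> \<open>d' \<in> D\<close> unfolding D_def by blast
    then have "c \<noteq> c'" using False by blast
    then show ?thesis using C(4) c False by (auto simp: pairwise_def orthogonal_def sgn_div_norm)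
  qed
  ultimately show thesis using C(1) by (intro that[of D]) (auto simp: orthonormal_def D_def)
qed

lemma inner_projection_residual:
  fixes D :: "'a::real_inner set"
  assumes "finite D" "orthonormal D" "d \<in> D"
  shows "d \<bullet> (x - (\<Sum>b\<in>D. (b \<bullet> x) *\<^sub>R b)) = 0"
proof -
  have "d \<bullet> (\<Sum>b\<in>D. (b \<bullet> x) *\<^sub>R b) = (\<Sum>b\<in>D. if d = b then b \<bullet> x else 0)"
    unfolding inner_sum_right using assms by (intro sum.cong) (auto simp: orthonormal_def)
  then show ?thesis using assms by (simp add: inner_diff_right)
qed

text \<open>The projection onto the span of \<open>F\<close> cannot be injective on a space of
  larger dimension. This dimension count drives both extremal bounds and the proof of infinite
  rank.\<close>

lemma span_meets_orthogonal_complement: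
  fixes F B :: "'a::real_inner set"
  assumes "finite F" "independent B" "card F < card B"
  obtains x where "x \<in> span B" "x \<noteq> 0" "\<forall>f\<in>F. f \<bullet> x = 0"
proof -
  obtain D where D: "finite D" "card D \<le> card F" "span D = span F" "orthonormal D"
    using orthonormal_spanning_set[OF assms(1)] by blast
  define P where "P x = (\<Sum>b\<in>D. (b \<bullet> x) *\<^sub>R b)" for x
  have "linear P"
    unfolding P_def by (intro linearI) (simp_all add: inner_add_right scaleR_add_left sum.distrib scaleR_sum_right)
  have "\<exists>x\<in>span B. x \<noteq> 0 \<and> P x = 0"
  proof (rule ccontr)
    assume "\<not> ?thesis"
    then have inj: "inj_on P (span B)"
      using linear_injective_on_subspace_0[OF \<open>linear P\<close> subspace_span] by blast
    have "independent (P ` B)"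
      using \<open>linear P\<close> assms(2) inj by (rule linear_independent_injective_image)
    moreover have "P ` B \<subseteq> span D"
      by (auto simp: P_def intro: span_sum span_scale span_base)
    ultimately have "card (P ` B) \<le> card D"
      using independent_span_bound[OF D(1)] by blast
    moreover have "card (P ` B) = card B"
      using inj by (intro card_image) (auto simp: inj_on_def span_base)
    ultimately show False using D(2) assms(3) by simp
  qed
  then obtain x where x: "x \<in> span B" "x \<noteq> 0" "P x = 0" by blast
  have "\<forall>d\<in>D. d \<bullet> x = 0"
    using inner_projection_residual[OF D(1,4), of _ x] x(3) by (simp add: P_def)
  then have "\<forall>f\<in>F. f \<bullet> x = 0"
    using inner_span_eq_0[of D x] D(3) span_base by blast
  with x show thesis using that by blast
qed

section \<open>Compactness from smallness on finite codimension\<close>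

text \<open>Takes the place of Heine-Borel in a finite-dimensional subspace: the set is a finite
  Minkowski sum of segments.\<close>

lemma compact_cube_span:
  fixes D :: "'a::real_normed_vector set"
  assumes "finite D"
  shows "compact {\<Sum>d\<in>D. c d *\<^sub>R d | c. \<forall>d\<in>D. \<bar>c d\<bar> \<le> M}"
  using assms
proof (induction D rule: finite_induct)
  case (insert d D)
  let ?S = "\<lambda>D. {\<Sum>d\<in>D. c d *\<^sub>R d | c. \<forall>d\<in>D. \<bar>c d\<bar> \<le> (M::real)}"
  have "compact ((\<lambda>t. t *\<^sub>R d) ` {-M..M})"
    by (intro compact_continuous_image continuous_intros) auto
  from compact_sums[OF this insert.IH]
  have "compact {x + y |x y. x \<in> (\<lambda>t. t *\<^sub>R d) ` {-M..M} \<and> y \<in> ?S D}" .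
  also have "{x + y |x y. x \<in> (\<lambda>t. t *\<^sub>R d) ` {-M..M} \<and> y \<in> ?S D} = ?S (insert d D)"
  proof (intro set_eqI iffI)
    fix z assume "z \<in> {x + y |x y. x \<in> (\<lambda>t. t *\<^sub>R d) ` {-M..M} \<and> y \<in> ?S D}"
    then obtain u v where "u \<in> (\<lambda>t. t *\<^sub>R d) ` {-M..M}" "v \<in> ?S D" and z: "z = u + v"
      by blast
    then obtain t c where "\<bar>t\<bar> \<le> M" "\<forall>d\<in>D. \<bar>c d\<bar> \<le> M" "u = t *\<^sub>R d" "v = (\<Sum>d\<in>D. c d *\<^sub>R d)"
      by (force simp: abs_le_iff)
    moreover have "(\<Sum>a\<in>D. (c(d := t)) a *\<^sub>R a) = (\<Sum>d\<in>D. c d *\<^sub>R d)"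
      using insert.hyps by (intro sum.cong) auto
    ultimately show "z \<in> ?S (insert d D)"
      using insert.hyps z by (intro CollectI exI[of _ "c(d := t)"]) auto
  next
    fix z assume "z \<in> ?S (insert d D)"
    then obtain c where c: "\<forall>d\<in>insert d D. \<bar>c d\<bar> \<le> M" "z = (\<Sum>d\<in>insert d D. c d *\<^sub>R d)"
      by auto
    then have "c d *\<^sub>R d \<in> (\<lambda>t. t *\<^sub>R d) ` {-M..M}" by (auto simp: abs_le_iff)
    with c insert.hyps show "z \<in> {x + y |x y. x \<in> (\<lambda>t. t *\<^sub>R d) ` {-M..M} \<and> y \<in> ?S D}"
      by auto
  qed
  finally show ?case .
qed simp

text \<open>Up to a small error \<open>T\<close> acts on a bounded set as it does on the projection
  of that set to a finite-dimensional space, whose image lies in a compact set. Hence the image of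
  the bounded set is totally bounded.\<close>

lemma compact_operatorI:
  fixes T :: "'a::real_inner \<Rightarrow> 'b::{real_inner, complete_space}"
  assumes T: "bounded_linear T"
    and small: "\<And>\<epsilon>. \<epsilon> > 0 \<Longrightarrow> \<exists>F. finite F \<and> (\<forall>x. (\<forall>f\<in>F. f \<bullet> x = 0) \<longrightarrow> norm (T x) \<le> \<epsilon> * norm x)"
  shows "compact_operator T"
  unfolding compact_operator_def
proof (intro conjI allI impI T)
  interpret T: bounded_linear T by fact
  fix S :: "'a set" assume "bounded S"
  then obtain M where M: "M > 0" "\<And>x. x \<in> S \<Longrightarrow> norm x \<le> M"
    unfolding bounded_pos by blast
  have "\<exists>k. finite k \<and> closure (T ` S) \<subseteq> (\<Union>x\<in>k. ball x \<epsilon>)" if "\<epsilon> > 0" for \<epsilon>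
  proof -
    \<comment> \<open>The residual x - p has norm at most \<open>M\<close>, so it contributes
      \<epsilon>/4. Together with the \<epsilon>/2-net this gives closed balls of radius
      3\<epsilon>/4, which contain the closure too and fit into open balls of radius
      \<epsilon>.\<close>
    define \<delta> where "\<delta> = \<epsilon> / (4 * M)"
    have "\<delta> > 0" using that M by (simp add: \<delta>_def)
    then obtain F where F: "finite F" "\<And>x. \<forall>f\<in>F. f \<bullet> x = 0 \<Longrightarrow> norm (T x) \<le> \<delta> * norm x"
      using small by blast
    obtain D where D: "finite D" "card D \<le> card F" "span D = span F" "orthonormal D"
      using orthonormal_spanning_set[OF F(1)] by blast
    define Q where "Q = {\<Sum>d\<in>D. c d *\<^sub>R d | c. \<forall>d\<in>D. \<bar>c d\<bar> \<le> M}"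
    have "compact (T ` Q)"
      unfolding Q_def by (intro compact_continuous_image compact_cube_span D T.continuous_on continuous_on_id)
    then obtain k where k: "finite k" "T ` Q \<subseteq> (\<Union>x\<in>k. ball x (\<epsilon>/2))"
      unfolding compact_eq_totally_bounded using \<open>\<epsilon> > 0\<close> by (meson half_gt_zero)
    have "T ` S \<subseteq> (\<Union>x\<in>k. cball x (3 * \<epsilon> / 4))"
    proof clarify
      fix x assume x: "x \<in> S"
      define p where "p = (\<Sum>b\<in>D. (b \<bullet> x) *\<^sub>R b)"
      have n1: "norm d = 1" if "d \<in> D" for d using D(4) that by (simp add: orthonormal_def norm_eq_sqrt_inner)
      have "\<bar>d \<bullet> x\<bar> \<le> M" if "d \<in> D" for d
        using Cauchy_Schwarz_ineq2[of d x] M(2)[OF x] n1[OF that] by simp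
      then have "p \<in> Q" unfolding Q_def p_def by (intro CollectI exI[of _ "\<lambda>d. d \<bullet> x"]) auto
      then obtain y where y: "y \<in> k" "dist y (T p) < \<epsilon> / 2" using k(2) by auto
      have r0: "\<forall>d\<in>D. d \<bullet> (x - p) = 0"
        unfolding p_def using inner_projection_residual[OF D(1,4)] by blast
      then have "\<forall>f\<in>F. f \<bullet> (x - p) = 0"
        using inner_span_eq_0[of D "x - p"] D(3) span_base by blast
      then have "norm (T (x - p)) \<le> \<delta> * norm (x - p)" by (rule F)
      also have "norm (x - p) \<le> M"
      proof -
        have "p \<bullet> (x - p) = 0"
          using r0 by (intro inner_span_eq_0[OF r0]) (auto simp: p_def intro: span_sum span_scale span_base)
        then have "(norm x)\<^sup>2 = (norm p)\<^sup>2 + (norm (x - p))\<^sup>2"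
          by (simp add: power2_norm_eq_inner inner_diff inner_commute)
        then have "(norm (x - p))\<^sup>2 \<le> (norm x)\<^sup>2" by simp
        then have "norm (x - p) \<le> norm x" by (rule power2_le_imp_le) simp
        then show ?thesis using M(2)[OF x] by simp
      qed
      finally have "norm (T (x - p)) \<le> \<delta> * M" using \<open>\<delta> > 0\<close> by simp
      then have "norm (T (x - p)) \<le> \<epsilon> / 4" using M by (simp add: \<delta>_def)
      then have "dist (T p) (T x) \<le> \<epsilon> / 4"
        by (simp add: dist_norm T.diff norm_minus_commute)
      then have "dist y (T x) \<le> 3 * \<epsilon> / 4"
        using y(2) dist_triangle[of y "T x" "T p"] by simp
      then show "T x \<in> (\<Union>x\<in>k. cball x (3 * \<epsilon> / 4))" using y(1) by auto
    qed
    then have "closure (T ` S) \<subseteq> (\<Union>x\<in>k. cball x (3 * \<epsilon> / 4))"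
      using k(1) by (intro closure_minimal closed_UN) auto
    also have "\<dots> \<subseteq> (\<Union>x\<in>k. ball x \<epsilon>)"
      using \<open>\<epsilon> > 0\<close> by (intro UN_mono) (auto simp: subset_iff)
    finally show ?thesis using k(1) by blast
  qed
  then show "compact (closure (T ` S))"
    unfolding compact_eq_totally_bounded by (simp add: complete_eq_closed)
qed

section \<open>Singular values of compact operators\<close>

lemma compact_operator_bounded_linear: "compact_operator T \<Longrightarrow> bounded_linear T"
  by (simp add: compact_operator_def)

lemma compact_operator_convergent_subseq:
  fixes u :: "nat \<Rightarrow> 'a::real_normed_vector"
  assumes "compact_operator T" "\<And>n. norm (u n) = 1"
  obtains y r where "strict_mono r" "(\<lambda>n. T (u (r n))) \<longlonglongrightarrow> y"
proof -
  have "compact (closure (T ` cball 0 1))"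
    using assms(1) bounded_cball unfolding compact_operator_def by blast
  moreover have "\<forall>n. (T \<circ> u) n \<in> closure (T ` cball 0 1)"
    using assms(2) by (intro allI closure_subset[THEN subsetD]) simp
  ultimately have "\<exists>y r. strict_mono r \<and> ((T \<circ> u) \<circ> r) \<longlonglongrightarrow> y"
    unfolding compact_def by blast
  then show thesis using that by (auto simp: comp_def)
qed

text \<open>A maximizing sequence \<open>u\<close> satisfies \<open>T\<^sup>*T u - \<sigma>\<^sup>2 u \<longlongrightarrow> 0\<close>, so compactness of \<open>T\<close> makes \<open>u\<close>
  itself subconvergent, and no weak topology is needed.\<close>

lemma compact_operator_attains_norm:
  fixes T :: "'a::{real_inner, complete_space} \<Rightarrow> 'b::{real_inner, complete_space}"
  assumes T: "compact_operator T"
    and V: "closed V" "subspace V" "\<And>x. x \<in> V \<Longrightarrow> adjoint T (T x) \<in> V"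
    and x0: "x0 \<in> V" "T x0 \<noteq> 0"
  obtains e where "e \<in> V" "norm e = 1" "T e \<noteq> 0"
    "\<And>x. x \<in> V \<Longrightarrow> norm (T x) \<le> norm (T e) * norm x"
    "adjoint T (T e) = (norm (T e))\<^sup>2 *\<^sub>R e"
proof -
  note bl = compact_operator_bounded_linear[OF T]
  interpret T: bounded_linear T by (rule bl)
  interpret T': bounded_linear "adjoint T" by (rule bounded_linear_adjoint[OF bl])
  define K where "K x = adjoint T (T x)" for x
  have K: "T x \<bullet> T y = x \<bullet> K y" for x y
    by (simp add: K_def inner_adjoint[OF bl])
  define N where "N = (\<lambda>x. norm (T x)) ` {x \<in> V. norm x = 1}"
  define \<sigma> where "\<sigma> = Sup N"
  obtain M where M: "\<And>x. norm (T x) \<le> norm x * M" using T.bounded by blast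
  have "bdd_above N"
    using M by (intro bdd_aboveI[of _ M]) (auto simp: N_def, metis mult_1)
  have sgn: "sgn x \<in> V" if "x \<in> V" for x
    using V(2) that by (simp add: sgn_div_norm subspace_scale)
  have le: "norm (T x) \<le> \<sigma> * norm x" if "x \<in> V" for x
  proof (cases "x = 0")
    case False
    then have "norm (T (sgn x)) \<in> N" using sgn[OF that] by (auto simp: N_def norm_sgn)
    then have "norm (T (sgn x)) \<le> \<sigma>" unfolding \<sigma>_def using \<open>bdd_above N\<close> by (rule cSup_upper)
    then show ?thesis using False by (simp add: sgn_div_norm T.scaleR field_simps)
  qed (simp add: T.zero)
  have "x0 \<noteq> 0" using x0(2) T.zero by blast
  have "\<sigma> > 0"
  proof -
    have "0 < norm (T x0)" using x0 by simp
    also have "\<dots> \<le> \<sigma> * norm x0" by (rule le) fact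
    finally show ?thesis using \<open>x0 \<noteq> 0\<close> by (simp add: zero_less_mult_iff)
  qed
  have "N \<noteq> {}" using sgn[OF x0(1)] \<open>x0 \<noteq> 0\<close> by (auto simp: N_def norm_sgn)
  have "\<exists>x\<in>V. norm x = 1 \<and> \<sigma> - inverse (real (Suc n)) < norm (T x)" for n
  proof -
    have "\<exists>a\<in>N. \<sigma> - inverse (real (Suc n)) < a"
      by (rule less_cSupE[OF _ \<open>N \<noteq> {}\<close>, of "\<sigma> - inverse (real (Suc n))"]) (auto simp: \<sigma>_def)
    then show ?thesis by (auto simp: N_def simp del: of_nat_Suc)
  qed
  then obtain u where u: "u n \<in> V" "norm (u n) = 1" "\<sigma> - inverse (real (Suc n)) < norm (T (u n))" for n
    by metis
  have u\<sigma>: "(\<lambda>n. norm (T (u n))) \<longlonglongrightarrow> \<sigma>"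
  proof (rule tendsto_sandwich[of "\<lambda>n. \<sigma> - inverse (real (Suc n))" _ _ "\<lambda>_. \<sigma>"])
    show "(\<lambda>n. \<sigma> - inverse (real (Suc n))) \<longlonglongrightarrow> \<sigma>"
      using tendsto_diff[OF tendsto_const LIMSEQ_inverse_real_of_nat, of \<sigma>] by simp
    show "\<forall>\<^sub>F n in sequentially. norm (T (u n)) \<le> \<sigma>"
      using le[OF u(1)] u(2) by (intro always_eventually) simp
  qed (use u in \<open>auto intro!: always_eventually less_imp_le simp del: of_nat_Suc\<close>)
  obtain y r where r: "strict_mono r" "(\<lambda>n. T (u (r n))) \<longlonglongrightarrow> y"
    using compact_operator_convergent_subseq[OF T, of u] u(2) by blast
  have Kz: "(\<lambda>n. K (u (r n))) \<longlonglongrightarrow> adjoint T y"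
    unfolding K_def by (rule T'.tendsto[OF r(2)])
  \<comment> \<open>Invariance of \<open>V\<close> under \<open>K\<close> allows the bound
    \<open>le\<close> to be applied to K (u n) as well.\<close>
  have norm_K: "norm (K (u n)) \<le> \<sigma>\<^sup>2" for n
  proof -
    have "(norm (K (u n)))\<^sup>2 = T (K (u n)) \<bullet> T (u n)" by (simp add: K power2_norm_eq_inner)
    also have "\<dots> \<le> norm (T (K (u n))) * norm (T (u n))" by (rule norm_cauchy_schwarz)
    also have "\<dots> \<le> (\<sigma> * norm (K (u n))) * (\<sigma> * norm (u n))"
      using \<open>\<sigma> > 0\<close> u(1) V(3) by (intro mult_mono le) (auto simp: K_def)
    finally have "norm (K (u n)) * norm (K (u n)) \<le> \<sigma>\<^sup>2 * norm (K (u n))"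
      by (simp add: u(2) power2_eq_square mult_ac)
    then show ?thesis
      by (cases "norm (K (u n)) = 0") auto
  qed
  \<comment> \<open>In the expansion of the square the mixed term is known exactly, because u
    \<bullet> K u = |T u|^2.\<close>
  have residual: "(norm (K (u n) - \<sigma>\<^sup>2 *\<^sub>R u n))\<^sup>2 \<le> 2 * \<sigma>\<^sup>2 * (\<sigma>\<^sup>2 - (norm (T (u n)))\<^sup>2)" for n
  proof -
    have "(norm (K (u n) - \<sigma>\<^sup>2 *\<^sub>R u n))\<^sup>2
        = (norm (K (u n)))\<^sup>2 - 2 * \<sigma>\<^sup>2 * (norm (T (u n)))\<^sup>2 + \<sigma>\<^sup>2 * \<sigma>\<^sup>2 * (norm (u n))\<^sup>2"
      by (simp add: power2_norm_eq_inner K inner_diff inner_commute algebra_simps)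
    also have "(norm (K (u n)))\<^sup>2 \<le> \<sigma>\<^sup>2 * \<sigma>\<^sup>2"
      using power_mono[OF norm_K[of n], of 2] by (simp add: power2_eq_square)
    finally show ?thesis using u(2) by (simp add: algebra_simps)
  qed
  have "(\<lambda>n. (norm (K (u (r n)) - \<sigma>\<^sup>2 *\<^sub>R u (r n)))\<^sup>2) \<longlonglongrightarrow> 0"
  proof (rule tendsto_sandwich[of "\<lambda>_. 0"])
    have "(\<lambda>n. norm (T (u (r n)))) \<longlonglongrightarrow> \<sigma>"
      using LIMSEQ_subseq_LIMSEQ[OF u\<sigma> r(1)] by (simp add: comp_def)
    then have "(\<lambda>n. 2 * \<sigma>\<^sup>2 * (\<sigma>\<^sup>2 - (norm (T (u (r n))))\<^sup>2)) \<longlonglongrightarrow> 2 * \<sigma>\<^sup>2 * (\<sigma>\<^sup>2 - \<sigma>\<^sup>2)"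
      by (intro tendsto_intros)
    then show "(\<lambda>n. 2 * \<sigma>\<^sup>2 * (\<sigma>\<^sup>2 - (norm (T (u (r n))))\<^sup>2)) \<longlonglongrightarrow> 0" by simp
  qed (use residual in \<open>auto intro!: always_eventually\<close>)
  then have "(\<lambda>n. K (u (r n)) - \<sigma>\<^sup>2 *\<^sub>R u (r n)) \<longlonglongrightarrow> 0"
    using tendsto_norm_zero_cancel by (force simp: tendsto_null_power)
  \<comment> \<open>Compactness gives convergence of T u only; K u converges with it, and since K u
    and \<sigma>^2 u are asymptotically equal, so does u.\<close>
  from tendsto_diff[OF Kz this] have "(\<lambda>n. \<sigma>\<^sup>2 *\<^sub>R u (r n)) \<longlonglongrightarrow> adjoint T y" by simp
  from tendsto_scaleR[OF tendsto_const this, of "inverse (\<sigma>\<^sup>2)"]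
  have ue: "(\<lambda>n. u (r n)) \<longlonglongrightarrow> inverse (\<sigma>\<^sup>2) *\<^sub>R adjoint T y"
    using \<open>\<sigma> > 0\<close> by simp
  define e where "e = inverse (\<sigma>\<^sup>2) *\<^sub>R adjoint T y"
  note ue = ue[folded e_def]
  have "e \<in> V" using closed_sequentially[OF V(1) _ ue] u(1) by simp
  moreover have "norm e = 1"
    using tendsto_norm[OF ue] u(2) by (simp add: LIMSEQ_const_iff)
  moreover have Te: "norm (T e) = \<sigma>"
    using LIMSEQ_subseq_LIMSEQ[OF u\<sigma> r(1)] tendsto_norm[OF T.tendsto[OF ue]]
    unfolding comp_def by (metis LIMSEQ_unique)
  moreover have "K e = \<sigma>\<^sup>2 *\<^sub>R e"
  proof -
    have "(\<lambda>n. K (u (r n))) \<longlonglongrightarrow> K e"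
      unfolding K_def by (intro T'.tendsto T.tendsto ue)
    then have "K e = adjoint T y" using Kz by (rule LIMSEQ_unique)
    then show ?thesis using \<open>\<sigma> > 0\<close> by (simp add: e_def)
  qed
  ultimately show thesis using le \<open>\<sigma> > 0\<close> by (intro that[of e]) (auto simp: K_def)
qed

section \<open>Greedy construction of a complete list of singular vectors\<close>

text \<open>Phrased so that the greedy choice can always continue. For bounded operators on a
  Hilbert space it means that the range is infinite-dimensional.\<close>

definition infinite_rank :: "('a::real_inner \<Rightarrow> 'b::real_vector) \<Rightarrow> bool" where
  "infinite_rank T \<longleftrightarrow> (\<forall>F. finite F \<longrightarrow> (\<exists>x. (\<forall>f\<in>F. f \<bullet> x = 0) \<and> T x \<noteq> 0))"

text \<open>Besides the eigenvector equation, the third clause records that each vector maximizes |T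
  x| / |x| on the complement of its predecessors; monotonicity and the extremal bounds rest on it.
  Counting starts at 0, so \<open>e n\<close> belongs to the singular value with index n +
  1.\<close>

definition singular_vectors ::
    "('a::real_inner \<Rightarrow> 'b::real_inner) \<Rightarrow> (nat \<Rightarrow> 'a) \<Rightarrow> bool" where
  "singular_vectors T e \<longleftrightarrow>
     (\<forall>i j. e i \<bullet> e j = (if i = j then 1 else 0)) \<and>
     (\<forall>n. T (e n) \<noteq> 0) \<and>
     (\<forall>n x. (\<forall>i<n. e i \<bullet> x = 0) \<longrightarrow> norm (T x) \<le> norm (T (e n)) * norm x) \<and>
     (\<forall>n. adjoint T (T (e n)) = (norm (T (e n)))\<^sup>2 *\<^sub>R e n)"

lemma singular_vectorsD:
  assumes "singular_vectors T e"
  shows "e i \<bullet> e j = (if i = j then 1 else 0)" "T (e n) \<noteq> 0"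
    "(\<And>i. i < n \<Longrightarrow> e i \<bullet> x = 0) \<Longrightarrow> norm (T x) \<le> norm (T (e n)) * norm x"
    "adjoint T (T (e n)) = (norm (T (e n)))\<^sup>2 *\<^sub>R e n"
  using assms by (auto simp: singular_vectors_def)

text \<open>Recursion over the complement \<open>V\<close> of the vectors already chosen. It is
  invariant under T* T because these are eigenvectors, and infinite rank keeps \<open>T\<close>
  nonzero on it.\<close>

lemma singular_vectors_exist:
  fixes T :: "'a::{real_inner, complete_space} \<Rightarrow> 'b::{real_inner, complete_space}"
  assumes T: "compact_operator T" and rank: "infinite_rank T"
  obtains e where "singular_vectors T e"
proof -
  note bl = compact_operator_bounded_linear[OF T]
  interpret T: bounded_linear T by (rule bl)
  interpret T': bounded_linear "adjoint T" by (rule bounded_linear_adjoint[OF bl])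
  define P where "P f n e \<longleftrightarrow> (\<forall>i<n. f i \<bullet> e = 0) \<and> norm e = 1 \<and> T e \<noteq> 0 \<and>
      (\<forall>x. (\<forall>i<n. f i \<bullet> x = 0) \<longrightarrow> norm (T x) \<le> norm (T e) * norm x) \<and>
      adjoint T (T e) = (norm (T e))\<^sup>2 *\<^sub>R e" for f :: "nat \<Rightarrow> 'a" and n e
  have "\<exists>e. \<forall>n. P e n (e n)"
  proof (rule dependent_wellorder_choice)
    show "P f n e = P g n e" if "\<And>i. i < n \<Longrightarrow> f i = g i" for f g n e
      using that by (auto simp: P_def)
    fix n f assume IH: "\<And>i. i < n \<Longrightarrow> P f i (f i)"
    define V where "V = {x. \<forall>i<n. f i \<bullet> x = 0}"
    have "V = (\<Inter>i<n. {x. f i \<bullet> x = 0})" by (auto simp: V_def)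
    moreover have "closed {x. f i \<bullet> x = 0}" for i
      by (intro closed_Collect_eq continuous_intros)
    ultimately have "closed V" by auto
    moreover have "subspace V"
      by (auto simp: V_def intro!: subspaceI simp: inner_add_right)
    moreover have "adjoint T (T x) \<in> V" if "x \<in> V" for x
    proof -
      \<comment> \<open>Symmetry of T* T moves it to the eigenvector \<open>f i\<close>.\<close>
      have "f i \<bullet> adjoint T (T x) = 0" if "i < n" for i
      proof -
        have "f i \<bullet> adjoint T (T x) = x \<bullet> adjoint T (T (f i))"
          by (metis inner_adjoint[OF bl] inner_commute)
        also have "\<dots> = 0" using IH[OF that] \<open>x \<in> V\<close> that
          by (simp add: P_def V_def inner_commute)
        finally show ?thesis .
      qed
      then show ?thesis by (simp add: V_def)
    qed
    moreover obtain x0 where "x0 \<in> V" "T x0 \<noteq> 0"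
    proof -
      have "\<exists>x. (\<forall>a\<in>f ` {..<n}. a \<bullet> x = 0) \<and> T x \<noteq> 0"
        using rank unfolding infinite_rank_def by blast
      then show thesis using that by (auto simp: V_def)
    qed
    ultimately obtain e where "e \<in> V" "norm e = 1" "T e \<noteq> 0"
      "\<And>x. x \<in> V \<Longrightarrow> norm (T x) \<le> norm (T e) * norm x"
      "adjoint T (T e) = (norm (T e))\<^sup>2 *\<^sub>R e"
      using compact_operator_attains_norm[OF T, of V x0] by blast
    then show "\<exists>e. P f n e" by (auto simp: P_def V_def)
  qed
  then obtain e where e: "\<And>n. P e n (e n)" by blast
  have "e i \<bullet> e j = (if i = j then 1 else 0)" for i j
  proof (cases i j rule: linorder_cases)
    case equal
    then show ?thesis using e[of i] by (simp add: P_def norm_eq_1)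
  next
    case less
    then show ?thesis using e[of j] by (simp add: P_def)
  next
    case greater
    then have "e j \<bullet> e i = 0" using e[of i] by (simp add: P_def)
    then show ?thesis using greater by (simp add: inner_commute)
  qed
  then show thesis using e by (intro that[of e]) (auto simp: P_def singular_vectors_def)
qed

text \<open>The images of the singular vectors are orthogonal, so compactness forces their norms to
  0. By maximality, whatever is orthogonal to all singular vectors lies in the kernel, so no
  positive singular value is missed and the multiplicities are right. The shift by 1 reconciles
  counting from 0 with counting from 1.\<close>

lemma singular_value_sequence_singular_vectors:
  fixes T :: "'a::{real_inner, complete_space} \<Rightarrow> 'b::{real_inner, complete_space}"
  assumes T: "compact_operator T"
    and e: "singular_vectors T e"
  shows "singular_value_sequence T (\<lambda>n. norm (T (e (n - 1))))"
proof -
  note bl = compact_operator_bounded_linear[OF T]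
  interpret T: bounded_linear T by (rule bl)
  interpret T': bounded_linear "adjoint T" by (rule bounded_linear_adjoint[OF bl])
  note ortho = singular_vectorsD(1)[OF e] and nz = singular_vectorsD(2)[OF e]
    and max = singular_vectorsD(3)[OF e] and eigen = singular_vectorsD(4)[OF e]
  define s where "s n = norm (T (e n))" for n
  have s_pos: "s n > 0" for n using nz by (simp add: s_def)
  have norm_e: "norm (e n) = 1" for n using ortho[of n n] by (simp add: norm_eq_1)
  have anti: "s n \<le> s m" if "m \<le> n" for m n
    using max[of m "e n"] that by (simp add: ortho norm_e s_def)
  have "decseq s" using anti by (simp add: decseq_def)
  have inner_T: "T (e i) \<bullet> T x = (s i)\<^sup>2 * (e i \<bullet> x)" for i x
    using inner_adjoint[OF bl, of x "T (e i)"] eigen[of i] by (simp add: s_def inner_commute)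
  have s0: "s \<longlonglongrightarrow> 0"
  proof -
    obtain L where L: "s \<longlonglongrightarrow> L" "\<And>n. L \<le> s n"
      using decseq_convergent[OF \<open>decseq s\<close>, of 0] s_pos by (metis less_imp_le)
    obtain y r where r: "strict_mono r" "(\<lambda>n. T (e (r n))) \<longlonglongrightarrow> y"
      using compact_operator_convergent_subseq[OF T, of e] norm_e by blast
    \<comment> \<open>By Pythagoras the distance of two orthogonal images exceeds either norm, while
      along a convergent subsequence consecutive distances vanish.\<close>
    have "s (r n) \<le> dist (T (e (r n))) (T (e (r (Suc n))))" for n
    proof -
      have "r n \<noteq> r (Suc n)" using r(1) by (simp add: strict_mono_eq)
      then have "(dist (T (e (r n))) (T (e (r (Suc n)))))\<^sup>2 = (s (r n))\<^sup>2 + (s (r (Suc n)))\<^sup>2"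
        unfolding dist_norm power2_norm_eq_inner
        by (simp add: inner_diff inner_T ortho inner_commute)
      then have "(s (r n))\<^sup>2 \<le> (dist (T (e (r n))) (T (e (r (Suc n)))))\<^sup>2" by simp
      then show ?thesis by (rule power2_le_imp_le) simp
    qed
    then have "L \<le> dist (T (e (r n))) (T (e (r (Suc n))))" for n
      using L(2) order_trans by blast
    moreover have "(\<lambda>n. dist (T (e (r n))) (T (e (r (Suc n))))) \<longlonglongrightarrow> dist y y"
      using r(2) LIMSEQ_Suc[OF r(2)] by (rule tendsto_dist)
    ultimately have "L \<le> dist y y" by (intro LIMSEQ_le_const) auto
    moreover have "0 \<le> L" using LIMSEQ_le_const[OF L(1)] s_pos by (meson less_imp_le)
    ultimately show ?thesis using L(1) by simp
  qed
  have "\<exists>B. finite B \<and> independent B \<and> span B = singular_space T t \<and>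
      card B = card {n. 1 \<le> n \<and> s (n - 1) = t}" if "t > 0" for t
  proof (intro exI conjI)
    define I where "I = {n. s n = t}"
    have "\<forall>\<^sub>F n in sequentially. s n < t" using s0 that by (rule order_tendstoD)
    then obtain k where "\<And>n. n \<ge> k \<Longrightarrow> s n < t" by (auto simp: eventually_sequentially)
    then have "I \<subseteq> {..<k}" unfolding I_def by (force simp: not_le[symmetric])
    then show fin: "finite (e ` I)" by (intro finite_imageI) (rule finite_subset, auto)
    have "inj e"
      by (rule injI) (metis ortho zero_neq_one)
    have finI: "finite I" using \<open>I \<subseteq> {..<k}\<close> finite_subset by blast
    show "independent (e ` I)"
      by (intro pairwise_orthogonal_independent)
        (auto simp: pairwise_def orthogonal_def ortho, metis norm_e norm_zero zero_neq_one)
    have "{n. 1 \<le> n \<and> s (n - 1) = t} = Suc ` I"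
      unfolding I_def by (auto simp: image_iff) (metis Suc_pred' diff_Suc_1 One_nat_def Suc_le_eq)
    then show "card (e ` I) = card {n. 1 \<le> n \<and> s (n - 1) = t}"
      using \<open>inj e\<close> by (simp add: card_image inj_on_subset)
    show "span (e ` I) = singular_space T t"
    proof (intro equalityI subsetI)
      fix x assume "x \<in> span (e ` I)"
      then show "x \<in> singular_space T t"
      proof (induction rule: span_induct_alt)
        case (step c x y)
        then show ?case
          using eigen by (auto simp: singular_space_def I_def s_def T.add T.scaleR T'.add T'.scaleR scaleR_add_right)
      qed (simp add: singular_space_def T.zero T'.zero)
    next
      fix x assume "x \<in> singular_space T t"
      then have x: "adjoint T (T x) = t\<^sup>2 *\<^sub>R x" by (simp add: singular_space_def)
      define y where "y = x - (\<Sum>i\<in>I. (e i \<bullet> x) *\<^sub>R e i)"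
      have sum: "(\<Sum>i\<in>I. (e i \<bullet> x) *\<^sub>R e i) \<in> span (e ` I)"
        by (intro span_sum span_scale span_base) auto
      have Ky: "adjoint T (T y) = t\<^sup>2 *\<^sub>R y"
        unfolding y_def T.diff T'.diff T.sum T'.sum T.scaleR T'.scaleR x eigen scaleR_diff_right scaleR_sum_right
        by (simp add: I_def s_def mult.commute)
      \<comment> \<open>For \<open>n\<close> in \<open>I\<close> the component was subtracted;
        otherwise \<open>e n\<close> and \<open>y\<close> satisfy the eigenvector equation for
        different eigenvalues of a symmetric operator.\<close>
      have ey: "e n \<bullet> y = 0" for n
      proof (cases "n \<in> I")
        case True
        have "e n \<bullet> (\<Sum>i\<in>I. (e i \<bullet> x) *\<^sub>R e i) = (\<Sum>i\<in>I. if n = i then e i \<bullet> x else 0)"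
          unfolding inner_sum_right by (intro sum.cong) (auto simp: ortho)
        then show ?thesis using True finI by (simp add: y_def inner_diff_right)
      next
        case False
        have "(s n)\<^sup>2 * (e n \<bullet> y) = t\<^sup>2 * (e n \<bullet> y)"
          using inner_T[of n y] inner_adjoint[OF bl, of "e n" "T y"] Ky by auto
        moreover have "(s n)\<^sup>2 \<noteq> t\<^sup>2"
          using False s_pos[of n] that by (simp add: I_def power2_eq_iff)
        ultimately show ?thesis by simp
      qed
      have "norm (T y) \<le> s n * norm y" for n
        using max[of n y] ey by (simp add: s_def)
      moreover have "(\<lambda>n. s n * norm y) \<longlonglongrightarrow> 0 * norm y"
        by (intro tendsto_intros s0)
      ultimately have "norm (T y) \<le> 0" by (intro LIMSEQ_le_const[of "\<lambda>n. s n * norm y"]) auto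
      \<comment> \<open>Here T y = 0 and T* T y = t^2 y with t > 0.\<close>
      then have "y = 0" using Ky that T'.zero by simp
      then show "x \<in> span (e ` I)" using sum by (simp add: y_def)
    qed
  qed
  moreover have "(\<lambda>n. s (n - 1)) \<longlonglongrightarrow> 0"
    by (rule LIMSEQ_imp_Suc) (simp add: s0)
  ultimately show ?thesis
    unfolding singular_value_sequence_def s_def[symmetric]
    using s_pos anti by (auto intro: diff_le_mono)
qed

section \<open>Extremal bounds and the degree of ill-posedness\<close>

text \<open>On the span of the first \<open>n\<close> singular vectors |T x| is at least the n-th
  singular value times |x|. This span has dimension greater than \<open>card F\<close>, so it
  contains a nonzero vector to which the assumed bound applies.\<close>

lemma singular_value_le:
  fixes T :: "'a::{real_inner, complete_space} \<Rightarrow> 'b::{real_inner, complete_space}"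
  assumes T: "compact_operator T" and rank: "infinite_rank T"
    and F: "finite F" "card F < n" "\<And>x. \<forall>f\<in>F. f \<bullet> x = 0 \<Longrightarrow> norm (T x) \<le> c * norm x"
  shows "singular_value T n \<le> c"
proof -
  note bl = compact_operator_bounded_linear[OF T]
  interpret T: bounded_linear T by (rule bl)
  obtain e where sv: "singular_vectors T e"
    using singular_vectors_exist[OF T rank] by blast
  note e = singular_vectorsD[OF sv]
  have seq: "singular_value_sequence T (\<lambda>n. norm (T (e (n - 1))))"
    using singular_value_sequence_singular_vectors[OF T sv] .
  define s where "s n = norm (T (e n))" for n
  have "inj e" by (rule injI) (metis e(1) zero_neq_one)
  have "independent (e ` {..<n})"
    by (intro pairwise_orthogonal_independent)
      (auto simp: pairwise_def orthogonal_def e(1), metis e(1) inner_zero_left zero_neq_one)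
  moreover have "card F < card (e ` {..<n})"
    using F(2) \<open>inj e\<close> by (simp add: card_image inj_on_subset)
  ultimately obtain x where x: "x \<in> span (e ` {..<n})" "x \<noteq> 0" "\<forall>f\<in>F. f \<bullet> x = 0"
    using span_meets_orthogonal_complement[OF F(1)] by blast
  obtain a where "x = (\<Sum>v\<in>e ` {..<n}. a v *\<^sub>R v)"
    using x(1) by (auto simp: span_finite)
  then have xa: "x = (\<Sum>i<n. a (e i) *\<^sub>R e i)"
    using \<open>inj e\<close> by (simp add: sum.reindex inj_on_subset comp_def)
  have TT: "T (e i) \<bullet> T (e j) = (if i = j then (s i)\<^sup>2 else 0)" for i j
    using inner_adjoint[OF bl, of "e i" "T (e j)"] e(4)[of j] by (simp add: e(1) s_def)
  \<comment> \<open>Pythagoras is applied before and after \<open>T\<close>, since singular vectors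
    and their images are both orthogonal families.\<close>
  have "(s (n - 1))\<^sup>2 * (norm x)\<^sup>2 = (\<Sum>i<n. (s (n - 1))\<^sup>2 * (norm (a (e i) *\<^sub>R e i))\<^sup>2)"
    unfolding xa sum_distrib_left[symmetric]
    by (subst norm_sum_Pythagorean) (auto simp: pairwise_def orthogonal_def e(1))
  also have "\<dots> \<le> (\<Sum>i<n. (norm (a (e i) *\<^sub>R T (e i)))\<^sup>2)"
  proof (rule sum_mono)
    fix i assume "i \<in> {..<n}"
    then have "s (n - 1) \<le> s i"
      using seq unfolding singular_value_sequence_def s_def
      by (metis (no_types, lifting) diff_Suc_1 le_add1 plus_1_eq_Suc Suc_leI lessThan_iff)
    then have "(s (n - 1))\<^sup>2 \<le> (s i)\<^sup>2" by (intro power_mono) (auto simp: s_def)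
    then have "(s (n - 1))\<^sup>2 * (a (e i))\<^sup>2 \<le> (s i)\<^sup>2 * (a (e i))\<^sup>2" by (rule mult_right_mono) simp
    moreover have "norm (e i) = 1" using e(1)[of i i] by (simp add: norm_eq_1)
    ultimately show "(s (n - 1))\<^sup>2 * (norm (a (e i) *\<^sub>R e i))\<^sup>2 \<le> (norm (a (e i) *\<^sub>R T (e i)))\<^sup>2"
      by (simp add: s_def power_mult_distrib mult.commute)
  qed
  also have "\<dots> = (norm (T x))\<^sup>2"
    unfolding xa T.sum T.scaleR
    by (subst norm_sum_Pythagorean) (auto simp: pairwise_def orthogonal_def TT)
  also have "\<dots> \<le> (c * norm x)\<^sup>2"
    using F(3)[of x] x(3) by (intro power_mono) auto
  finally have "(s (n - 1) * norm x)\<^sup>2 \<le> (c * norm x)\<^sup>2" by (simp add: power_mult_distrib)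
  \<comment> \<open>Needed to remove the squares; the sign is read off from the assumed bound at
    \<open>x\<close>.\<close>
  moreover have "0 \<le> c * norm x" using F(3)[of x] x(3) norm_ge_zero[of "T x"] by (meson order_trans)
  ultimately have "s (n - 1) * norm x \<le> c * norm x" by (rule power2_le_imp_le)
  then have "s (n - 1) \<le> c" using x(2) by simp
  then show ?thesis using singular_value_eq[OF seq, of n] F(2) by (simp add: s_def)
qed

text \<open>The span of \<open>B\<close> meets the complement of the first n - 1 singular vectors,
  where |T x| is at most the n-th singular value times |x|.\<close>

lemma singular_value_ge:
  fixes T :: "'a::{real_inner, complete_space} \<Rightarrow> 'b::{real_inner, complete_space}"
  assumes T: "compact_operator T" and rank: "infinite_rank T"
    and B: "independent B" "card B = n" "n > 0" "\<And>x. x \<in> span B \<Longrightarrow> c * norm x \<le> norm (T x)"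
  shows "c \<le> singular_value T n"
proof -
  obtain e where sv: "singular_vectors T e"
    using singular_vectors_exist[OF T rank] by blast
  note e = singular_vectorsD[OF sv]
  have seq: "singular_value_sequence T (\<lambda>n. norm (T (e (n - 1))))"
    using singular_value_sequence_singular_vectors[OF T sv] .
  have "card (e ` {..<n - 1}) < card B"
    using card_image_le[of "{..<n - 1}" e] B(2,3) by simp
  then obtain x where x: "x \<in> span B" "x \<noteq> 0" "\<forall>f\<in>e ` {..<n - 1}. f \<bullet> x = 0"
    using span_meets_orthogonal_complement[of "e ` {..<n - 1}" B] B(1) by blast
  have "c * norm x \<le> norm (T x)" using x(1) by (rule B)
  also have "\<dots> \<le> norm (T (e (n - 1))) * norm x" using x(3) by (intro e(3)) auto
  finally have "c \<le> norm (T (e (n - 1)))" using x(2) by simp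
  then show ?thesis using singular_value_eq[OF seq, of n] B(3) by simp
qed

text \<open>In dimension \<open>card F\<close> + 1 a nonzero vector orthogonal to \<open>F\<close>
  exists, and the lower bound keeps its image nonzero.\<close>

lemma infinite_rankI:
  fixes T :: "'a::real_inner \<Rightarrow> 'b::real_normed_vector"
  assumes "\<And>n. n > 0 \<Longrightarrow> \<exists>B c. independent B \<and> card B = n \<and> 0 < c \<and> (\<forall>x\<in>span B. c * norm x \<le> norm (T x))"
  shows "infinite_rank T"
  unfolding infinite_rank_def
proof (intro allI impI)
  fix F :: "'a set" assume F: "finite F"
  obtain B c where B: "independent B" "card B = Suc (card F)" "0 < c" "\<And>x. x \<in> span B \<Longrightarrow> c * norm x \<le> norm (T x)"
    using assms[of "Suc (card F)"] by auto
  then obtain x where x: "x \<in> span B" "x \<noteq> 0" "\<forall>f\<in>F. f \<bullet> x = 0"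
    using span_meets_orthogonal_complement[OF F, of B] by auto
  then have "0 < c * norm x" using B(3) by simp
  also have "\<dots> \<le> norm (T x)" using x(1) by (rule B)
  finally show "\<exists>x. (\<forall>f\<in>F. f \<bullet> x = 0) \<and> T x \<noteq> 0" using x(3) by auto
qed

text \<open>After taking logarithms the constants contribute only ln c / ln n and ln C / ln n, which
  tend to 0.\<close>

lemma ill_posed_of_degreeI:
  assumes "(\<lambda>n. singular_value T n) \<asymp> (\<lambda>n. 1 / real n ^ p)" "0 < p"
  shows "ill_posed_of_degree T (real p)"
proof -
  define \<sigma> where "\<sigma> n = singular_value T n" for n
  obtain c C where c: "0 < c" "c \<le> C"
    and bounds: "\<forall>\<^sub>F n in sequentially. c * (1 / real n ^ p) \<le> \<sigma> n \<and> \<sigma> n \<le> C * (1 / real n ^ p)"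
    using assms(1) unfolding asymp_comparable_def \<sigma>_def by blast
  have lim: "(\<lambda>n. real p - ln K / ln (real n)) \<longlonglongrightarrow> real p" for K
  proof -
    have "filterlim (\<lambda>n. ln (real n)) at_infinity sequentially"
      by (intro filterlim_at_top_imp_at_infinity filterlim_compose[OF ln_at_top filterlim_real_sequentially])
    from tendsto_diff[OF tendsto_const tendsto_divide_0[OF tendsto_const this]]
    show ?thesis by simp
  qed
  \<comment> \<open>The minus sign exchanges the roles: the upper constant \<open>C\<close> gives
    the lower bound. From n = 2 on, ln n is positive.\<close>
  have ineq: "real p - ln C / ln (real n) \<le> - ln (\<sigma> n) / ln (real n) \<and>
      - ln (\<sigma> n) / ln (real n) \<le> real p - ln c / ln (real n)"
    if "n \<ge> 2" "c * (1 / real n ^ p) \<le> \<sigma> n \<and> \<sigma> n \<le> C * (1 / real n ^ p)" for n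
  proof -
    have n: "ln (real n) > 0" using that(1) by simp
    have pos: "0 < c * (1 / real n ^ p)" using c that(1) by simp
    have eq: "ln (K * (1 / real n ^ p)) = ln K - real p * ln (real n)" if "K > 0" for K
      using that \<open>n \<ge> 2\<close> by (simp add: ln_div ln_realpow)
    have "ln c - real p * ln (real n) \<le> ln (\<sigma> n)"
      using that(2) pos c by (subst eq[symmetric]) (auto intro!: ln_mono)
    moreover have "ln (\<sigma> n) \<le> ln C - real p * ln (real n)"
      using that(2) pos c by (subst eq[symmetric]) (auto intro!: ln_mono)
    moreover have quot: "real p - ln K / ln (real n) = (real p * ln (real n) - ln K) / ln (real n)" for K
      using n by (simp add: diff_divide_distrib)
    ultimately show ?thesis using n by (simp only: quot) (intro conjI divide_right_mono, auto)
  qed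
  have "(\<lambda>n. - ln (\<sigma> n) / ln (real n)) \<longlonglongrightarrow> real p"
  proof (rule tendsto_sandwich[OF _ _ lim lim])
    show "\<forall>\<^sub>F n in sequentially. real p - ln C / ln (real n) \<le> - ln (\<sigma> n) / ln (real n)"
      using bounds eventually_ge_at_top[of 2] by eventually_elim (use ineq in blast)
    show "\<forall>\<^sub>F n in sequentially. - ln (\<sigma> n) / ln (real n) \<le> real p - ln c / ln (real n)"
      using bounds eventually_ge_at_top[of 2] by eventually_elim (use ineq in blast)
  qed
  then have "(\<lambda>n. ereal (- ln (\<sigma> n) / ln (real n))) \<longlonglongrightarrow> ereal (real p)" by simp
  then show ?thesis
    using assms(2) unfolding ill_posed_of_degree_def ill_posedness_lower_def ill_posedness_upper_def \<sigma>_def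
    by (auto intro!: lim_imp_Liminf lim_imp_Limsup)
qed

section \<open>Integrals over the unit interval and the two operators\<close>

lemma measurable_indicator_unit:
  "(indicator {a<..b} :: real \<Rightarrow> real) \<in> borel_measurable unit_measure"
  by (rule unit_measure_borel) measurable

lemma set_integrable_unit:
  assumes "integrable unit_measure f"
  shows "set_integrable unit_measure {a<..b::real} (f :: real \<Rightarrow> real)"
  unfolding set_integrable_def
proof (rule Bochner_Integration.integrable_bound[OF assms])
  show "(\<lambda>t. indicator {a<..b} t *\<^sub>R f t) \<in> borel_measurable unit_measure"
    using measurable_indicator_unit[of a b] assms by measurable
qed (simp add: indicator_def)

lemma set_integral_unit_split:
  fixes f :: "real \<Rightarrow> real"
  assumes "integrable unit_measure f" "a \<le> b" "b \<le> c"
  shows "(LINT t:{a<..c}|unit_measure. f t)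
    = (LINT t:{a<..b}|unit_measure. f t) + (LINT t:{b<..c}|unit_measure. f t)"
proof -
  have "(LINT t:{a<..b}|unit_measure. f t) + (LINT t:{b<..c}|unit_measure. f t)
      = (LINT t|unit_measure. indicator {a<..b} t *\<^sub>R f t + indicator {b<..c} t *\<^sub>R f t)"
    unfolding set_lebesgue_integral_def
    using set_integrable_unit[OF assms(1)] unfolding set_integrable_def
    by (intro Bochner_Integration.integral_add[symmetric])
  also have "\<dots> = (LINT t:{a<..c}|unit_measure. f t)"
    unfolding set_lebesgue_integral_def
    by (rule Bochner_Integration.integral_cong) (use assms(2,3) in \<open>auto simp: indicator_def\<close>)
  finally show ?thesis by simp
qed

lemma set_integral_unit_whole:
  "(LINT t:{0<..1}|unit_measure. f t) = (LINT t|unit_measure. (f t :: real))"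
  unfolding set_lebesgue_integral_def
  by (rule Bochner_Integration.integral_cong) (auto simp: indicator_def)

lemma set_integral_unit_partition:
  fixes f :: "real \<Rightarrow> real" and \<tau> :: "nat \<Rightarrow> real"
  assumes "integrable unit_measure f" "mono \<tau>" "\<tau> 0 = 0"
  shows "(LINT t:{0<..\<tau> n}|unit_measure. f t) = (\<Sum>k<n. LINT t:{\<tau> k<..\<tau> (Suc k)}|unit_measure. f t)"
proof (induction n)
  case 0
  then show ?case using assms(3) by (simp add: set_lebesgue_integral_def)
next
  case (Suc n)
  have "0 \<le> \<tau> n" "\<tau> n \<le> \<tau> (Suc n)" using assms(2,3) by (metis monoD le0, simp add: monoD)
  then show ?case using set_integral_unit_split[OF assms(1), of 0 "\<tau> n" "\<tau> (Suc n)"] Suc by simp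
qed

lemma set_integral_unit_FTC:
  fixes f F :: "real \<Rightarrow> real"
  assumes "0 \<le> a" "a \<le> b" "b \<le> 1"
    and "\<And>x. (F has_real_derivative f x) (at x)" "\<And>x. isCont f x"
  shows "(LINT t:{a<..b}|unit_measure. f t) = F b - F a"
proof -
  have [measurable]: "f \<in> borel_measurable borel"
    using assms(5) by (intro borel_measurable_continuous_onI) (simp add: continuous_on_eq_continuous_at)
  have "(LINT t:{a<..b}|unit_measure. f t)
      = (LINT t|lebesgue. indicator {0<..<1} t *\<^sub>R (indicator {a<..b} t *\<^sub>R f t))"
    unfolding set_lebesgue_integral_def by (rule integral_restrict_space) simp
  also have "\<dots> = (LINT t|lborel. indicator {0<..<1} t *\<^sub>R (indicator {a<..b} t *\<^sub>R f t))"
    by (rule integral_completion) measurable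
  also have "\<dots> = (LINT t|lborel. f t * indicator {a..b} t)"
  proof (rule integral_cong_AE)
    \<comment> \<open>The two integrands differ at most at the endpoints; this covers a = 0 and b =
      1, which the open unit interval excludes.\<close>
    show "AE t in lborel. indicator {0<..<1} t *\<^sub>R (indicator {a<..b} t *\<^sub>R f t) = f t * indicator {a..b} t"
      using AE_lborel_singleton[of a] AE_lborel_singleton[of b]
      by eventually_elim (use assms(1-3) in \<open>auto simp: indicator_def\<close>)
  qed measurable
  also have "\<dots> = F b - F a"
    using assms by (intro integral_FTC_Icc_real) auto
  finally show ?thesis .
qed

lemma set_integral_unit_const:
  assumes "0 \<le> a" "a \<le> b" "b \<le> 1"
  shows "(LINT t:{a<..b}|unit_measure. c) = (b - a) * c"
proof -
  have "((\<lambda>x. c * x) has_real_derivative c) (at x)" for x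
    by (auto intro!: derivative_eq_intros)
  from set_integral_unit_FTC[OF assms this] show ?thesis by (simp add: algebra_simps)
qed

lemma integral_unit_const: "(LINT t|unit_measure. c) = (c :: real)"
  using set_integral_unit_const[of 0 1 c] unfolding set_integral_unit_whole by simp

lemma set_integral_unit_le:
  fixes f :: "real \<Rightarrow> real"
  assumes "0 \<le> a" "a \<le> b" "b \<le> 1" "integrable unit_measure f"
    and "\<And>t. a < t \<Longrightarrow> t \<le> b \<Longrightarrow> t < 1 \<Longrightarrow> f t \<le> c"
  shows "(LINT t:{a<..b}|unit_measure. f t) \<le> (b - a) * c"
  unfolding set_integral_unit_const[OF assms(1-3), symmetric] set_lebesgue_integral_def
proof (rule integral_mono)
  show "integrable unit_measure (\<lambda>t. indicator {a<..b} t *\<^sub>R f t)"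
    using set_integrable_unit[OF assms(4)] by (simp add: set_integrable_def)
  have "integrable unit_measure (\<lambda>t. c)"
    by (rule sq_integrable_integrable[OF sq_integrable_const])
  then show "integrable unit_measure (\<lambda>t. indicator {a<..b} t *\<^sub>R c)"
    using set_integrable_unit[of "\<lambda>_. c"] by (simp only: set_integrable_def)
qed (use assms(5) in \<open>auto simp: indicator_def\<close>)

lemma set_integral_unit_mono_set:
  fixes f :: "real \<Rightarrow> real"
  assumes "integrable unit_measure f" "\<And>t. 0 \<le> f t" "b \<le> c"
  shows "(LINT t:{a<..b}|unit_measure. f t) \<le> (LINT t:{a<..c}|unit_measure. f t)"
  unfolding set_lebesgue_integral_def
  using set_integrable_unit[OF assms(1)] unfolding set_integrable_def
  by (intro integral_mono) (use assms(2,3) in \<open>auto simp: indicator_def\<close>)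

lemma inner_abs_L2:
  "sq_integrable f \<Longrightarrow> sq_integrable g \<Longrightarrow> abs_L2 f \<bullet> abs_L2 g = (LINT t|unit_measure. f t * g t)"
  by (simp add: inner_L2.abs_eq L2_rel_refl)

lemma abs_L2_eqI: "L2_rel f g \<Longrightarrow> abs_L2 f = abs_L2 g"
  using Quotient3_rel_abs[OF Quotient3_L2] by blast

lemma sq_integrable_bounded:
  assumes "f \<in> borel_measurable borel" "\<And>t. \<bar>f t\<bar> \<le> M"
  shows "sq_integrable f"
proof -
  have m: "f \<in> borel_measurable unit_measure" using assms(1) by (rule unit_measure_borel)
  moreover have "integrable unit_measure (\<lambda>t. (f t)\<^sup>2)"
  proof (rule finite_measure.integrable_const_bound[OF finite_measure_unit])
    show "AE t in unit_measure. norm ((f t)\<^sup>2) \<le> M\<^sup>2"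
      using assms(2) by (auto intro!: AE_I2 abs_le_square_iff[THEN iffD1] intro: order_trans[OF _ abs_ge_self])
  qed (use m in measurable)
  ultimately show ?thesis by (simp add: sq_integrable_def)
qed

lemma sq_integrable_indicator: "sq_integrable (indicator {a<..b})"
  by (rule sq_integrable_bounded[where M = 1]) (auto simp: indicator_def)

lemma inner_indicator_abs_L2:
  "sq_integrable f \<Longrightarrow> abs_L2 (indicator {a<..b}) \<bullet> abs_L2 f = (LINT t:{a<..b}|unit_measure. f t)"
  by (simp add: inner_abs_L2 sq_integrable_indicator set_lebesgue_integral_def)

text \<open>Cauchy-Schwarz in \<open>L2\<close> for the indicator and \<open>f\<close>, where
  \<open>f\<close> is first cut off to the interval so that the right-hand side becomes
  local.\<close>

lemma set_integral_unit_Cauchy_Schwarz: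
  assumes f: "sq_integrable f" and ab: "0 \<le> a" "a \<le> b" "b \<le> 1"
  shows "(LINT t:{a<..b}|unit_measure. f t)\<^sup>2 \<le> (b - a) * (LINT t:{a<..b}|unit_measure. (f t)\<^sup>2)"
proof -
  have m: "(\<lambda>t. indicator {a<..b} t * f t) \<in> borel_measurable unit_measure"
    using measurable_indicator_unit[of a b] sq_integrable_measurable[OF f] by measurable
  have sq: "(indicator {a<..b} t * f t)\<^sup>2 = indicator {a<..b} t *\<^sub>R (f t)\<^sup>2" for t :: real
    by (simp add: indicator_def)
  have f': "sq_integrable (\<lambda>t. indicator {a<..b} t * f t)"
    using m set_integrable_unit[of "\<lambda>t. (f t)\<^sup>2" a b] f
    unfolding sq_integrable_def sq set_integrable_def by blast
  have "(abs_L2 (indicator {a<..b}) \<bullet> abs_L2 (\<lambda>t. indicator {a<..b} t * f t))\<^sup>2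
      \<le> (abs_L2 (indicator {a<..b}) \<bullet> abs_L2 (indicator {a<..b})) *
         (abs_L2 (\<lambda>t. indicator {a<..b} t * f t) \<bullet> abs_L2 (\<lambda>t. indicator {a<..b} t * f t))"
    by (rule Cauchy_Schwarz_ineq)
  also have "abs_L2 (indicator {a<..b}) \<bullet> abs_L2 (\<lambda>t. indicator {a<..b} t * f t)
      = (LINT t:{a<..b}|unit_measure. f t)"
    unfolding inner_abs_L2[OF sq_integrable_indicator f'] set_lebesgue_integral_def
    by (rule Bochner_Integration.integral_cong) (auto simp: indicator_def)
  also have "abs_L2 (indicator {a<..b}) \<bullet> abs_L2 (indicator {a<..b}) = (LINT t:{a<..b}|unit_measure. 1)"
    unfolding inner_abs_L2[OF sq_integrable_indicator sq_integrable_indicator] set_lebesgue_integral_def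
    by (rule Bochner_Integration.integral_cong) (auto simp: indicator_def)
  also have "\<dots> = b - a" using set_integral_unit_const[OF ab, of 1] by simp
  also have "abs_L2 (\<lambda>t. indicator {a<..b} t * f t) \<bullet> abs_L2 (\<lambda>t. indicator {a<..b} t * f t)
      = (LINT t:{a<..b}|unit_measure. (f t)\<^sup>2)"
    unfolding inner_abs_L2[OF f' f'] set_lebesgue_integral_def
    by (rule Bochner_Integration.integral_cong) (auto simp: indicator_def power2_eq_square)
  finally show ?thesis .
qed

lemma norm_abs_L2: "sq_integrable f \<Longrightarrow> (norm (abs_L2 f))\<^sup>2 = (LINT t|unit_measure. (f t)\<^sup>2)"
  unfolding power2_norm_eq_inner by (simp add: inner_abs_L2 power2_eq_square)

lemma norm_abs_L2_mono:
  assumes "sq_integrable f" "sq_integrable g" "\<And>t. 0 < t \<Longrightarrow> t < 1 \<Longrightarrow> \<bar>f t\<bar> \<le> \<bar>g t\<bar>"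
  shows "norm (abs_L2 f) \<le> norm (abs_L2 g)"
proof (rule power2_le_imp_le)
  show "(norm (abs_L2 f))\<^sup>2 \<le> (norm (abs_L2 g))\<^sup>2"
    unfolding norm_abs_L2[OF assms(1)] norm_abs_L2[OF assms(2)]
    using assms by (intro integral_mono) (auto simp: sq_integrable_def abs_le_square_iff)
qed simp

abbreviation primitive :: "(real \<Rightarrow> real) \<Rightarrow> real \<Rightarrow> real" where
  "primitive f s \<equiv> LINT t:{0<..s}|unit_measure. f t"

lemma integration_op_abs_L2: "sq_integrable f \<Longrightarrow> integration_op (abs_L2 f) = abs_L2 (primitive f)"
  by (simp add: integration_op.abs_eq L2_rel_refl)

lemma Cesaro_op_abs_L2: "sq_integrable f \<Longrightarrow> Cesaro_op (abs_L2 f) = abs_L2 (\<lambda>s. 1 / s * primitive f s)"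
  by (simp add: Cesaro_op.abs_eq L2_rel_refl)

lemma norm_integration_op_le_Cesaro_op: "norm (integration_op x) \<le> norm (Cesaro_op x)"
proof -
  obtain f where f: "sq_integrable f" "x = abs_L2 f" by (rule abs_L2_cases)
  have "\<bar>a\<bar> \<le> \<bar>1 / s * a\<bar>" if "0 < s" "s < 1" for a s :: real
    using that by (simp add: abs_mult field_simps mult_left_le_one_le)
  then show ?thesis
    using f by (simp only: integration_op_abs_L2 Cesaro_op_abs_L2)
      (intro norm_abs_L2_mono sq_integrable_primitive sq_integrable_Cesaro)
qed

text \<open>The constant is the root of the 4 in \<open>Hardy_inequality\<close>.\<close>

lemma norm_Cesaro_op_le: "norm (Cesaro_op x) \<le> 2 * norm x"
proof -
  obtain f where f: "sq_integrable f" "x = abs_L2 f" by (rule abs_L2_cases)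
  have nn: "ennreal ((norm (abs_L2 g))\<^sup>2) = (\<integral>\<^sup>+t. ennreal ((g t)\<^sup>2) \<partial>unit_measure)"
    if "sq_integrable g" for g
    using that unfolding norm_abs_L2[OF that]
    by (intro nn_integral_eq_integral[symmetric]) (auto simp: sq_integrable_def)
  have "ennreal ((norm (Cesaro_op x))\<^sup>2) \<le> 4 * ennreal ((norm x)\<^sup>2)"
    using Hardy_inequality[OF f(1)]
    by (simp only: f(2) Cesaro_op_abs_L2[OF f(1)] nn[OF sq_integrable_Cesaro[OF f(1)]] nn[OF f(1)])
  also have "\<dots> = ennreal ((2 * norm x)\<^sup>2)"
    by (simp add: power_mult_distrib ennreal_mult')
  finally have "(norm (Cesaro_op x))\<^sup>2 \<le> (2 * norm x)\<^sup>2"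
    by (subst (asm) ennreal_le_iff) auto
  then show ?thesis by (rule power2_le_imp_le) simp
qed

lemma primitive_add:
  assumes "sq_integrable f" "sq_integrable g"
  shows "primitive (\<lambda>t. f t + g t) s = primitive f s + primitive g s"
  using assms by (intro set_integral_add(2) set_integrable_unit sq_integrable_integrable)

lemma bounded_linear_Cesaro_op: "bounded_linear Cesaro_op"
proof (rule bounded_linear_intro[where K = 2])
  show "Cesaro_op (x + y) = Cesaro_op x + Cesaro_op y" for x y
    by transfer (auto simp: L2_rel_refl primitive_add add_divide_distrib
        intro!: sq_integrable_add sq_integrable_Cesaro[simplified])
  show "Cesaro_op (r *\<^sub>R x) = r *\<^sub>R Cesaro_op x" for r x
    by transfer (auto simp: L2_rel_refl mult.left_commute[of _ r]
        intro!: sq_integrable_Cesaro[OF sq_integrable_scale, simplified])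
  show "norm (Cesaro_op x) \<le> norm x * 2" for x
    using norm_Cesaro_op_le[of x] by simp
qed

lemma bounded_linear_integration_op: "bounded_linear integration_op"
proof (rule bounded_linear_intro[where K = 2])
  show "integration_op (x + y) = integration_op x + integration_op y" for x y
    by transfer (auto simp: L2_rel_refl primitive_add intro!: sq_integrable_add sq_integrable_primitive)
  show "integration_op (r *\<^sub>R x) = r *\<^sub>R integration_op x" for r x
    by transfer (auto simp: L2_rel_refl intro!: sq_integrable_primitive sq_integrable_scale)
  show "norm (integration_op x) \<le> norm x * 2" for x
    using norm_integration_op_le_Cesaro_op[of x] norm_Cesaro_op_le[of x] by simp
qed

text \<open>Turns point evaluation of the first and second primitive into inner products with fixed
  elements of \<open>L2\<close>, so that vanishing at a node is an orthogonality condition.\<close>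

lemma inner_indicator_integration_op:
  assumes "sq_integrable f"
  shows "abs_L2 (indicator {0<..s}) \<bullet> abs_L2 f = primitive f s"
    and "adjoint integration_op (abs_L2 (indicator {0<..s})) \<bullet> abs_L2 f = primitive (primitive f) s"
proof -
  show "abs_L2 (indicator {0<..s}) \<bullet> abs_L2 f = primitive f s" 
    by (rule inner_indicator_abs_L2[OF assms])
  have "adjoint integration_op (abs_L2 (indicator {0<..s})) \<bullet> abs_L2 f
      = abs_L2 (indicator {0<..s}) \<bullet> integration_op (abs_L2 f)"
    using inner_adjoint[OF bounded_linear_integration_op] by (metis inner_commute)
  also have "\<dots> = primitive (primitive f) s"
    using assms by (simp only: integration_op_abs_L2 inner_indicator_abs_L2 sq_integrable_primitive)
  finally show "adjoint integration_op (abs_L2 (indicator {0<..s})) \<bullet> abs_L2 f = primitive (primitive f) s" .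
qed

section \<open>Upper estimate on the graded mesh\<close>

text \<open>Vanishing at \<open>a\<close> lets both integrations start at \<open>a\<close>.
  Cauchy-Schwarz for the inner one gives a factor s - a; for the outer one it gives the length s - a
  and the integral of a constant over that length. The energy is taken up to \<open>b\<close>, which
  makes it the same for all \<open>s\<close> in a cell.\<close>

lemma second_primitive_local_bound:
  assumes f: "sq_integrable f" and ab: "0 \<le> a" "a \<le> s" "s \<le> b" "s \<le> 1"
    and zero: "primitive f a = 0" "primitive (primitive f) a = 0"
  shows "(primitive (primitive f) s)\<^sup>2 \<le> (s - a) ^ 3 * (LINT t:{a<..b}|unit_measure. (f t)\<^sup>2)"
proof -
  define E where "E = (LINT t:{a<..b}|unit_measure. (f t)\<^sup>2)"
  have f2: "integrable unit_measure (\<lambda>t. (f t)\<^sup>2)" using f by (simp add: sq_integrable_def)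
  have first: "(primitive f t)\<^sup>2 \<le> (s - a) * E" if "a < t" "t \<le> s" for t
  proof -
    have "primitive f t = (LINT r:{a<..t}|unit_measure. f r)"
      using set_integral_unit_split[OF sq_integrable_integrable[OF f], of 0 a t] ab that zero by simp
    then have "(primitive f t)\<^sup>2 \<le> (t - a) * (LINT r:{a<..t}|unit_measure. (f r)\<^sup>2)"
      using set_integral_unit_Cauchy_Schwarz[OF f, of a t] ab that by simp
    also have "\<dots> \<le> (s - a) * E"
      unfolding E_def using that ab set_integral_unit_mono_set[OF f2, of a a t]
      by (intro mult_mono set_integral_unit_mono_set[OF f2]) (auto simp: set_lebesgue_integral_def)
    finally show ?thesis .
  qed
  note g = sq_integrable_primitive[OF f]
  have "primitive (primitive f) s = (LINT t:{a<..s}|unit_measure. primitive f t)"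
    using set_integral_unit_split[OF sq_integrable_integrable[OF g], of 0 a s] ab zero by simp
  then have "(primitive (primitive f) s)\<^sup>2 \<le> (s - a) * (LINT t:{a<..s}|unit_measure. (primitive f t)\<^sup>2)"
    using set_integral_unit_Cauchy_Schwarz[OF g, of a s] ab by simp
  also have "\<dots> \<le> (s - a) * ((s - a) * ((s - a) * E))"
    using ab first g by (intro mult_left_mono set_integral_unit_le) (auto simp: sq_integrable_def)
  finally show ?thesis by (simp add: E_def power3_eq_cube mult.assoc)
qed

text \<open>The mesh \<open>(k/n)\<^sup>2\<close> is graded so that the singular weight \<open>1/s\<close> of the Cesaro operator costs only a
  constant factor on each cell.\<close>

definition mesh :: "nat \<Rightarrow> nat \<Rightarrow> real" where
  "mesh n k = (real k / real n)\<^sup>2"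

text \<open>Cell width times the weighted local factor. With cell width \<delta> and left end a > 0
  it is at most (\<delta>^2 / a)^2, and the grading makes \<delta>^2 / a at most 9/n^2, uniformly in
  \<open>k\<close>.\<close>

lemma mesh_cell_bound:
  assumes "n > 0" "k < n" "mesh n k < s" "s \<le> mesh n (Suc k)"
  shows "(mesh n (Suc k) - mesh n k) * ((s - mesh n k) ^ 3 / s\<^sup>2) \<le> (9 / (real n)\<^sup>2)\<^sup>2"
proof (cases "k = 0")
  case True
  \<comment> \<open>In the first cell the left end is 0 and the weight cancels: s^3 / s^2 = s. The
    constant 9 comes from the other cells.\<close>
  then have s: "0 < s" "s \<le> 1 / (real n)\<^sup>2" using assms by (auto simp: mesh_def power_divide)
  have "(1 / (real n)\<^sup>2) * s \<le> (1 / (real n)\<^sup>2) * (1 / (real n)\<^sup>2)"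
    using s by (intro mult_left_mono) auto
  also have "\<dots> \<le> (9 / (real n)\<^sup>2) * (9 / (real n)\<^sup>2)"
    by (intro mult_mono divide_right_mono) auto
  finally show ?thesis
    using True s by (simp add: mesh_def power2_eq_square power3_eq_cube)
next
  case False
  define a where "a = mesh n k"
  define \<delta> where "\<delta> = mesh n (Suc k) - mesh n k"
  have "a > 0" using False assms(1) by (simp add: a_def mesh_def)
  have "\<delta> = (2 * real k + 1) / (real n)\<^sup>2"
    by (simp add: \<delta>_def mesh_def power_divide diff_divide_distrib[symmetric] power2_eq_square algebra_simps)
  \<comment> \<open>For k \<ge> 1; the square of this 3 is the 9 of the final bound.\<close>
  also have "\<dots> \<le> (3 * real k) / (real n)\<^sup>2"
    using False by (intro divide_right_mono) auto
  finally have \<delta>: "\<delta> \<le> 3 * real k / (real n)\<^sup>2" .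
  have "0 < \<delta>" using assms(3,4) by (simp add: \<delta>_def)
  have "\<delta> * ((s - a) ^ 3 / s\<^sup>2) \<le> \<delta> * (\<delta> ^ 3 / a\<^sup>2)"
    using assms(3,4) \<open>a > 0\<close> \<open>0 < \<delta>\<close>
    by (intro mult_left_mono frac_le power_mono) (auto simp: a_def \<delta>_def)
  also have "\<dots> = (\<delta>\<^sup>2 / a)\<^sup>2" by (simp add: power2_eq_square power3_eq_cube)
  also have "\<dots> \<le> (9 / (real n)\<^sup>2)\<^sup>2"
  proof (rule power_mono)
    have "\<delta>\<^sup>2 \<le> (3 * real k / (real n)\<^sup>2)\<^sup>2" using \<delta> \<open>0 < \<delta>\<close> by (intro power_mono) auto
    also have "\<dots> = 9 / (real n)\<^sup>2 * a" by (simp add: a_def mesh_def power_divide power_mult_distrib power2_eq_square)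
    finally show "\<delta>\<^sup>2 / a \<le> 9 / (real n)\<^sup>2" using \<open>a > 0\<close> by (simp add: field_simps)
  qed (use \<open>a > 0\<close> in simp)
  finally show ?thesis by (simp add: a_def \<delta>_def)
qed

text \<open>Each of the nodes 1 to n carries two conditions; at the node 0 both primitives vanish by
  themselves. The cell estimates have a common constant, so their sum is bounded by the full
  energy.\<close>

lemma Cesaro_integration_small_on_finite_codimension:
  assumes "n > 0"
  shows "\<exists>F. finite F \<and> card F \<le> 2 * n \<and> (\<forall>x. (\<forall>f\<in>F. f \<bullet> x = 0) \<longrightarrow>
    norm (Cesaro_op (integration_op x)) \<le> 9 / (real n)\<^sup>2 * norm x)"
proof -
  define \<tau> where "\<tau> = mesh n"
  define v where "v k = abs_L2 (indicator {0<..\<tau> k})" for k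
  define F where "F = v ` {1..n} \<union> (\<lambda>k. adjoint integration_op (v k)) ` {1..n}"
  have "card F \<le> card (v ` {1..n}) + card ((\<lambda>k. adjoint integration_op (v k)) ` {1..n})"
    unfolding F_def by (rule card_Un_le)
  also have "\<dots> \<le> card {1..n} + card {1..n}" by (intro add_mono card_image_le) auto
  finally have "card F \<le> 2 * n" by simp
  have \<tau>: "mono \<tau>" "\<tau> 0 = 0" "\<tau> n = 1"
    using assms by (auto simp: \<tau>_def mesh_def mono_def intro!: power_mono divide_right_mono)
  have \<tau>01: "0 \<le> \<tau> k" "k \<le> n \<Longrightarrow> \<tau> k \<le> 1" for k
    using \<tau> by (metis le0 monoD) (metis \<tau>(1,3) monoD)
  have "norm (Cesaro_op (integration_op x)) \<le> 9 / (real n)\<^sup>2 * norm x"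
    if "\<And>f. f \<in> F \<Longrightarrow> f \<bullet> x = 0" for x
  proof -
    obtain f where f: "sq_integrable f" "x = abs_L2 f" by (rule abs_L2_cases)
    note g = sq_integrable_primitive[OF f(1)]
    define h where "h s = 1 / s * primitive (primitive f) s" for s
    have h: "sq_integrable h" unfolding h_def by (rule sq_integrable_Cesaro[OF g])
    have Ax: "Cesaro_op (integration_op x) = abs_L2 h"
      by (simp only: f(2) integration_op_abs_L2[OF f(1)] Cesaro_op_abs_L2[OF g] h_def[abs_def])
    define E where "E k = (LINT t:{\<tau> k<..\<tau> (Suc k)}|unit_measure. (f t)\<^sup>2)" for k
    have f2: "integrable unit_measure (\<lambda>t. (f t)\<^sup>2)" and h2: "integrable unit_measure (\<lambda>t. (h t)\<^sup>2)"
      using f(1) h by (auto simp: sq_integrable_def)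
    have zero: "primitive f (\<tau> k) = 0" "primitive (primitive f) (\<tau> k) = 0" if "k \<le> n" for k
    proof -
      have "v k \<in> F \<and> adjoint integration_op (v k) \<in> F" if "k \<noteq> 0"
        using that \<open>k \<le> n\<close> by (auto simp: F_def)
      then show "primitive f (\<tau> k) = 0" "primitive (primitive f) (\<tau> k) = 0"
        using \<open>\<And>f. f \<in> F \<Longrightarrow> f \<bullet> x = 0\<close> inner_indicator_integration_op[OF f(1), of "\<tau> k"] \<tau>(2)
        unfolding f(2) v_def by (cases "k = 0"; force simp: set_lebesgue_integral_def)+
    qed
    have cell: "(LINT s:{\<tau> k<..\<tau> (Suc k)}|unit_measure. (h s)\<^sup>2) \<le> (9 / (real n)\<^sup>2)\<^sup>2 * E k" if "k < n" for k
    proof -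
      define \<delta> where "\<delta> = \<tau> (Suc k) - \<tau> k"
      have "\<delta> > 0" using assms by (simp add: \<delta>_def \<tau>_def mesh_def power_strict_mono divide_strict_right_mono)
      have "E k \<ge> 0" unfolding E_def set_lebesgue_integral_def by (intro integral_nonneg_AE) auto
      have "(LINT s:{\<tau> k<..\<tau> (Suc k)}|unit_measure. (h s)\<^sup>2)
          \<le> (\<tau> (Suc k) - \<tau> k) * ((9 / (real n)\<^sup>2)\<^sup>2 / \<delta> * E k)"
      proof (rule set_integral_unit_le[OF _ _ _ h2])
        fix s assume s: "\<tau> k < s" "s \<le> \<tau> (Suc k)" "s < 1"
        have "0 < s" using s(1) \<tau>01(1)[of k] by simp
        have "(h s)\<^sup>2 = (primitive (primitive f) s)\<^sup>2 / s\<^sup>2"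
          by (simp add: h_def power_divide)
        also have "\<dots> \<le> ((s - \<tau> k) ^ 3 * E k) / s\<^sup>2"
          unfolding E_def using s that \<tau>01(1)[of k] zero[of k]
          by (intro divide_right_mono second_primitive_local_bound[OF f(1)]) auto
        also have "\<dots> = (s - \<tau> k) ^ 3 / s\<^sup>2 * E k" by simp
        also have "\<dots> \<le> (9 / (real n)\<^sup>2)\<^sup>2 / \<delta> * E k"
        proof (rule mult_right_mono[OF _ \<open>E k \<ge> 0\<close>])
          have "\<delta> * ((s - \<tau> k) ^ 3 / s\<^sup>2) \<le> (9 / (real n)\<^sup>2)\<^sup>2"
            unfolding \<delta>_def \<tau>_def using s by (intro mesh_cell_bound[OF assms that]) (auto simp: \<tau>_def)
          then show "(s - \<tau> k) ^ 3 / s\<^sup>2 \<le> (9 / (real n)\<^sup>2)\<^sup>2 / \<delta>"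
            using \<open>\<delta> > 0\<close> by (subst pos_le_divide_eq) (simp_all add: mult.commute)
        qed
        finally show "(h s)\<^sup>2 \<le> (9 / (real n)\<^sup>2)\<^sup>2 / \<delta> * E k" .
      qed (use \<tau>01 that \<open>\<delta> > 0\<close> in \<open>auto simp: \<delta>_def\<close>)
      also have "\<dots> = (9 / (real n)\<^sup>2)\<^sup>2 * E k"
        using \<open>\<delta> > 0\<close> by (simp add: \<delta>_def[symmetric])
      finally show ?thesis .
    qed
    have "(norm (abs_L2 h))\<^sup>2 = (\<Sum>k<n. LINT s:{\<tau> k<..\<tau> (Suc k)}|unit_measure. (h s)\<^sup>2)"
      using set_integral_unit_partition[OF h2 \<tau>(1,2), of n] set_integral_unit_whole[of "\<lambda>s. (h s)\<^sup>2"]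
      by (simp add: norm_abs_L2[OF h] \<tau>(3))
    also have "\<dots> \<le> (\<Sum>k<n. (9 / (real n)\<^sup>2)\<^sup>2 * E k)"
      using cell by (intro sum_mono) auto
    also have "\<dots> = (9 / (real n)\<^sup>2)\<^sup>2 * (\<Sum>k<n. E k)"
      by (rule sum_distrib_left[symmetric])
    also have "(\<Sum>k<n. E k) = (norm x)\<^sup>2"
      using set_integral_unit_partition[OF f2 \<tau>(1,2), of n] set_integral_unit_whole[of "\<lambda>s. (f s)\<^sup>2"]
      unfolding f(2) by (simp add: norm_abs_L2[OF f(1)] \<tau>(3) E_def)
    finally have "(norm (abs_L2 h))\<^sup>2 \<le> (9 / (real n)\<^sup>2 * norm x)\<^sup>2"
      by (simp only: power_mult_distrib)
    then show ?thesis unfolding Ax by (rule power2_le_imp_le) simp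
  qed
  with \<open>card F \<le> 2 * n\<close> show ?thesis by (intro exI[of _ F]) (auto simp: F_def)
qed

section \<open>Lower estimate on spans of cosines\<close>

text \<open>Index 0 is included so that the constant function left over by double integration
  belongs to the same family.\<close>

definition cosine :: "nat \<Rightarrow> L2" where
  "cosine k = abs_L2 (\<lambda>t. cos (2 * pi * real k * t))"

lemma sq_integrable_cosine: "sq_integrable (\<lambda>t. cos (c * t))"
  by (rule sq_integrable_bounded[where M = 1]) auto

lemma primitive_cos:
  assumes "c \<noteq> 0" "0 \<le> s" "s \<le> 1"
  shows "primitive (\<lambda>t. cos (c * t)) s = sin (c * s) / c"
proof -
  have "((\<lambda>t. sin (c * t) / c) has_real_derivative cos (c * x)) (at x)" for x
    using assms(1) by (auto intro!: derivative_eq_intros)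
  from set_integral_unit_FTC[OF order_refl assms(2,3) this] show ?thesis by simp
qed

lemma primitive_sin:
  assumes "c \<noteq> 0" "0 \<le> s" "s \<le> 1"
  shows "primitive (\<lambda>t. sin (c * t) / c) s = (1 - cos (c * s)) / c\<^sup>2"
proof -
  have "((\<lambda>t. - cos (c * t) / c\<^sup>2) has_real_derivative sin (c * x) / c) (at x)" for x
    using assms(1) by (auto intro!: derivative_eq_intros simp: power2_eq_square)
  from set_integral_unit_FTC[OF order_refl assms(2,3) this] show ?thesis
    by (simp add: diff_divide_distrib assms(1))
qed

text \<open>Stated for integers because the product formula for two cosines produces the difference
  of their indices.\<close>

lemma integral_cos_eq_0:
  assumes "j \<noteq> 0"
  shows "(LINT t|unit_measure. cos (2 * pi * real_of_int j * t)) = 0"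
proof -
  have "sin (2 * pi * real_of_int j) = 0"
    using sin_zero_iff_int2[of "2 * pi * real_of_int j"] by (metis mult.commute mult.left_commute of_int_mult of_int_numeral)
  then show ?thesis
    using primitive_cos[of "2 * pi * real_of_int j" 1] assms
    unfolding set_integral_unit_whole by simp
qed

text \<open>For distinct natural numbers the sum and the difference are both nonzero, so both terms
  of the product formula integrate to 0. The case of index 0 is orthogonality to constants.\<close>

lemma inner_cosine:
  assumes "j \<noteq> k"
  shows "cosine j \<bullet> cosine k = 0"
proof -
  have i: "integrable unit_measure (\<lambda>t. 1/2 * cos (c * t))" for c :: real
    by (intro integrable_mult_right sq_integrable_integrable sq_integrable_cosine)
  have "cosine j \<bullet> cosine k
      = (LINT t|unit_measure. 1/2 * cos (2 * pi * real_of_int (int j - int k) * t)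
          + 1/2 * cos (2 * pi * real_of_int (int j + int k) * t))"
    unfolding cosine_def inner_abs_L2[OF sq_integrable_cosine sq_integrable_cosine]
    by (intro Bochner_Integration.integral_cong) (auto simp: cos_times_cos algebra_simps add_divide_distrib)
  also have "\<dots> = 1/2 * (LINT t|unit_measure. cos (2 * pi * real_of_int (int j - int k) * t))
      + 1/2 * (LINT t|unit_measure. cos (2 * pi * real_of_int (int j + int k) * t))"
    by (simp only: Bochner_Integration.integral_add[OF i i] integral_mult_right_zero)
  also have "\<dots> = 0"
    using integral_cos_eq_0[of "int j - int k"] integral_cos_eq_0[of "int j + int k"] assms by simp
  finally show ?thesis .
qed

lemma norm_cosine_pos: "0 < norm (cosine k)"
proof -
  have "0 < (LINT t|unit_measure. (cos (2 * pi * real k * t))\<^sup>2)"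
  proof (cases "k = 0")
    case True
    then show ?thesis by (simp add: integral_unit_const[of 1, simplified])
  next
    case False
    have half: "(cos y)\<^sup>2 = 1/2 + 1/2 * cos (2 * y)" for y :: real
      using cos_double_cos[of y] by (simp add: diff_divide_distrib)
    have "(LINT t|unit_measure. (cos (2 * pi * real k * t))\<^sup>2)
        = (LINT t|unit_measure. 1/2 + 1/2 * cos (2 * pi * real_of_int (2 * int k) * t))"
      by (intro Bochner_Integration.integral_cong) (simp_all add: half mult_ac)
    also have "\<dots> = (LINT t|unit_measure. 1/2) + 1/2 * (LINT t|unit_measure. cos (2 * pi * real_of_int (2 * int k) * t))"
    proof -
      have "integrable unit_measure (\<lambda>t. 1/2 :: real)"
        and "integrable unit_measure (\<lambda>t. 1/2 * cos (2 * pi * real_of_int (2 * int k) * t))"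
        by (intro integrable_mult_right sq_integrable_integrable sq_integrable_cosine sq_integrable_const)+
      then show ?thesis by (simp only: Bochner_Integration.integral_add integral_mult_right_zero)
    qed
    also have "\<dots> = 1/2"
      using integral_cos_eq_0[of "2 * int k"] False
      by (simp only: integral_unit_const)
    finally show ?thesis by simp
  qed
  then have "0 < (norm (cosine k))\<^sup>2"
    by (simp add: cosine_def norm_abs_L2 sq_integrable_cosine)
  then show ?thesis by (simp add: zero_less_power2)
qed

lemma integration_op_integration_op_cosine:
  assumes "k > 0"
  shows "integration_op (integration_op (cosine k)) = (1 / (2 * pi * real k)\<^sup>2) *\<^sub>R (cosine 0 - cosine k)"
proof -
  define c where "c = 2 * pi * real k"
  have c: "c \<noteq> 0" using assms by (simp add: c_def)
  note f = sq_integrable_cosine[of c]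
  note g = sq_integrable_primitive[OF f]
  have sin: "sq_integrable (\<lambda>t. sin (c * t) / c)"
    by (rule sq_integrable_bounded[where M = "1 / \<bar>c\<bar>"]) (auto simp: divide_right_mono)
  have one: "sq_integrable (\<lambda>t. 1 - cos (c * t))"
    by (intro sq_integrable_diff sq_integrable_const f)
  have "integration_op (cosine k) = abs_L2 (primitive (\<lambda>t. cos (c * t)))"
    unfolding cosine_def c_def[symmetric] by (rule integration_op_abs_L2[OF f])
  also have "\<dots> = abs_L2 (\<lambda>t. sin (c * t) / c)"
    using g sin c by (intro abs_L2_eqI) (auto simp: L2_rel_def primitive_cos intro!: AE_I2)
  finally have "integration_op (integration_op (cosine k)) = abs_L2 (primitive (\<lambda>t. sin (c * t) / c))"
    by (simp only: integration_op_abs_L2[OF sin])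
  also have "\<dots> = abs_L2 (\<lambda>t. 1 / c\<^sup>2 * (1 - cos (c * t)))"
    using sq_integrable_primitive[OF sin] sq_integrable_scale[OF one, of "1 / c\<^sup>2"] c
    by (intro abs_L2_eqI) (auto simp: L2_rel_def primitive_sin[simplified] intro!: AE_I2)
  also have "\<dots> = (1 / c\<^sup>2) *\<^sub>R abs_L2 (\<lambda>t. 1 - cos (c * t))"
    by (simp add: scaleR_L2.abs_eq L2_rel_refl one)
  also have "abs_L2 (\<lambda>t. 1 - cos (c * t)) = cosine 0 - cosine k"
    using sq_integrable_const[of 1] f sq_integrable_scale[OF f, of "-1"]
    by (simp add: cosine_def c_def minus_L2_def uminus_L2.abs_eq plus_L2.abs_eq L2_rel_refl)
  finally show ?thesis by (simp add: c_def)
qed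

lemma Cesaro_integration_large_on_cosines:
  assumes "n > 0"
  shows "independent (cosine ` {1..n})" "card (cosine ` {1..n}) = n"
    and "x \<in> span (cosine ` {1..n}) \<Longrightarrow>
      1 / (2 * pi * real n)\<^sup>2 * norm x \<le> norm (Cesaro_op (integration_op x))"
proof -
  interpret J: bounded_linear integration_op by (rule bounded_linear_integration_op)
  have inj: "inj_on cosine {1..n}"
    by (rule inj_onI) (metis inner_cosine inner_eq_zero_iff less_irrefl norm_cosine_pos norm_zero)
  show "card (cosine ` {1..n}) = n" using inj by (simp add: card_image)
  show "independent (cosine ` {1..n})"
  proof (rule pairwise_orthogonal_independent)
    show "0 \<notin> cosine ` {1..n}" using norm_cosine_pos by (metis imageE less_irrefl norm_zero)
  qed (auto simp: pairwise_def orthogonal_def, metis inner_cosine)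
  assume "x \<in> span (cosine ` {1..n})"
  then obtain a where "x = (\<Sum>v\<in>cosine ` {1..n}. a v *\<^sub>R v)" by (auto simp: span_finite)
  then have x: "x = (\<Sum>k\<in>{1..n}. a (cosine k) *\<^sub>R cosine k)"
    using inj by (simp add: sum.reindex)
  define \<omega> where "\<omega> k = 2 * pi * real k" for k
  define u where "u = (\<Sum>k\<in>{1..n}. (a (cosine k) / (\<omega> k)\<^sup>2) *\<^sub>R cosine k)"
  \<comment> \<open>Collects the constants that appear because every second primitive must vanish at
    0.\<close>
  define \<beta> where "\<beta> = (\<Sum>k\<in>{1..n}. a (cosine k) / (\<omega> k)\<^sup>2)"
  have "integration_op (integration_op x)
      = (\<Sum>k\<in>{1..n}. a (cosine k) *\<^sub>R ((1 / (\<omega> k)\<^sup>2) *\<^sub>R (cosine 0 - cosine k)))"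
    unfolding x J.sum J.scaleR \<omega>_def
    by (intro sum.cong refl) (simp add: integration_op_integration_op_cosine)
  also have "\<dots> = \<beta> *\<^sub>R cosine 0 - u"
    by (simp add: \<beta>_def u_def scaleR_diff_right sum_subtractf scaleR_sum_left)
  finally have JJ: "integration_op (integration_op x) = \<beta> *\<^sub>R cosine 0 - u" .
  have "cosine 0 \<bullet> u = 0"
    unfolding u_def inner_sum_right by (intro sum.neutral) (auto simp: inner_cosine)
  then have "(norm (\<beta> *\<^sub>R cosine 0 - u))\<^sup>2 = (norm (\<beta> *\<^sub>R cosine 0))\<^sup>2 + (norm u)\<^sup>2"
    unfolding power2_norm_eq_inner by (simp add: inner_diff inner_commute)
  then have u_le: "(norm u)\<^sup>2 \<le> (norm (integration_op (integration_op x)))\<^sup>2" unfolding JJ by simp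
  \<comment> \<open>Among the frequencies 1 to n the highest one is damped most, so its factor
    bounds all others from below.\<close>
  have "(1 / (\<omega> n)\<^sup>2 * norm x)\<^sup>2 = (1 / (\<omega> n)\<^sup>2)\<^sup>2 * (\<Sum>k\<in>{1..n}. (norm (a (cosine k) *\<^sub>R cosine k))\<^sup>2)"
    unfolding power_mult_distrib x
    by (subst norm_sum_Pythagorean) (auto simp: pairwise_def orthogonal_def inner_cosine)
  also have "\<dots> \<le> (\<Sum>k\<in>{1..n}. (norm ((a (cosine k) / (\<omega> k)\<^sup>2) *\<^sub>R cosine k))\<^sup>2)"
    unfolding sum_distrib_left
  proof (rule sum_mono)
    fix k assume k: "k \<in> {1..n}"
    then have "0 < \<omega> k" "\<omega> k \<le> \<omega> n" by (auto simp: \<omega>_def)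
    then have "1 / (\<omega> n)\<^sup>2 \<le> 1 / (\<omega> k)\<^sup>2" by (intro divide_left_mono power_mono) auto
    then have "(1 / (\<omega> n)\<^sup>2)\<^sup>2 \<le> (1 / (\<omega> k)\<^sup>2)\<^sup>2" by (rule power_mono) simp
    then have "(1 / (\<omega> n)\<^sup>2)\<^sup>2 * (norm (a (cosine k) *\<^sub>R cosine k))\<^sup>2
        \<le> (1 / (\<omega> k)\<^sup>2)\<^sup>2 * (norm (a (cosine k) *\<^sub>R cosine k))\<^sup>2"
      by (rule mult_right_mono) simp
    then show "(1 / (\<omega> n)\<^sup>2)\<^sup>2 * (norm (a (cosine k) *\<^sub>R cosine k))\<^sup>2
        \<le> (norm ((a (cosine k) / (\<omega> k)\<^sup>2) *\<^sub>R cosine k))\<^sup>2"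
      by (simp add: power_mult_distrib power_divide)
  qed
  also have "\<dots> = (norm u)\<^sup>2"
    unfolding u_def by (subst norm_sum_Pythagorean) (auto simp: pairwise_def orthogonal_def inner_cosine)
  also note u_le
  finally have "1 / (\<omega> n)\<^sup>2 * norm x \<le> norm (integration_op (integration_op x))"
    by (rule power2_le_imp_le) simp
  also have "\<dots> \<le> norm (Cesaro_op (integration_op x))"
    by (rule norm_integration_op_le_Cesaro_op)
  finally show "1 / (2 * pi * real n)\<^sup>2 * norm x \<le> norm (Cesaro_op (integration_op x))"
    by (simp add: \<omega>_def)
qed

theorem theorem1:
  fixes A :: "L2 \<Rightarrow> L2"
  assumes "A = Cesaro_op \<circ> integration_op"
  shows "compact_operator A \<and>
         (\<lambda>n. singular_value A n) \<asymp> (\<lambda>n. 1 / (real n)\<^sup>2) \<and>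
         ill_posed_of_degree A 2"
proof -
  have A: "A x = Cesaro_op (integration_op x)" for x by (simp add: assms)
  have "bounded_linear A"
    unfolding assms comp_def
    by (rule bounded_linear_compose[OF bounded_linear_Cesaro_op bounded_linear_integration_op])
  have compact: "compact_operator A"
  proof (rule compact_operatorI[OF \<open>bounded_linear A\<close>])
    fix \<epsilon> :: real assume "\<epsilon> > 0"
    obtain n where "inverse (real (Suc n)) < \<epsilon> / 9"
      using reals_Archimedean[of "\<epsilon> / 9"] \<open>\<epsilon> > 0\<close> by auto
    then have "9 / real (Suc n) \<le> \<epsilon>" by (simp add: inverse_eq_divide field_simps)
    \<comment> \<open>Compactness needs no rate, so the decay 1/n suffices for choosing
      \<open>n\<close>.\<close>
    moreover have "9 / (real (Suc n))\<^sup>2 \<le> 9 / real (Suc n)"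
      by (intro divide_left_mono) (auto simp: power2_eq_square)
    ultimately have n: "9 / (real (Suc n))\<^sup>2 \<le> \<epsilon>" by linarith
    obtain F where F: "finite F"
      "\<And>x. \<forall>f\<in>F. f \<bullet> x = 0 \<Longrightarrow> norm (A x) \<le> 9 / (real (Suc n))\<^sup>2 * norm x"
      using Cesaro_integration_small_on_finite_codimension[of "Suc n"] unfolding A by blast
    have "norm (A x) \<le> \<epsilon> * norm x" if "\<forall>f\<in>F. f \<bullet> x = 0" for x
      using F(2)[of x] that mult_right_mono[OF n, of "norm x"] by (meson norm_ge_zero order_trans)
    then show "\<exists>F. finite F \<and> (\<forall>x. (\<forall>f\<in>F. f \<bullet> x = 0) \<longrightarrow> norm (A x) \<le> \<epsilon> * norm x)"
      using F(1) by blast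
  qed
  have lower: "1 / (2 * pi * real n)\<^sup>2 * norm x \<le> norm (A x)" if "n > 0" "x \<in> span (cosine ` {1..n})" for n x
    unfolding A using that by (rule Cesaro_integration_large_on_cosines)
  have rank: "infinite_rank A"
  proof (rule infinite_rankI)
    fix n :: nat assume "n > 0"
    then show "\<exists>B c. independent B \<and> card B = n \<and> 0 < c \<and> (\<forall>x\<in>span B. c * norm x \<le> norm (A x))"
      using Cesaro_integration_large_on_cosines(1,2) lower
      by (intro exI[of _ "cosine ` {1..n}"] exI[of _ "1 / (2 * pi * real n)\<^sup>2"]) auto
  qed
  have ge: "1 / (2 * pi)\<^sup>2 * (1 / (real n)\<^sup>2) \<le> singular_value A n" if "n > 0" for n
    using singular_value_ge[OF compact rank Cesaro_integration_large_on_cosines(1,2)[OF that] that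
        lower[OF that]]
    by (simp add: power_mult_distrib)
  have le: "singular_value A n \<le> 144 * (1 / (real n)\<^sup>2)" if "n \<ge> 3" for n
  proof -
    \<comment> \<open>The largest \<open>m\<close> with 2m < n, as the 2m conditions must number
      fewer than \<open>n\<close>. From n = 3 on it is positive, and n \<le> 4m gives the constant
      144 = 9 * 16.\<close>
    define m where "m = (n - 1) div 2"
    have m: "m > 0" "2 * m < n" "n \<le> 4 * m" using that unfolding m_def by presburger+
    obtain F where F: "finite F" "card F \<le> 2 * m"
      "\<And>x. \<forall>f\<in>F. f \<bullet> x = 0 \<Longrightarrow> norm (A x) \<le> 9 / (real m)\<^sup>2 * norm x"
      using Cesaro_integration_small_on_finite_codimension[OF m(1)] unfolding A by blast
    have "card F < n" using F(2) m(2) by simp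
    then have "singular_value A n \<le> 9 / (real m)\<^sup>2"
      using singular_value_le[OF compact rank F(1) _ F(3)] by blast
    also have "\<dots> \<le> 9 / (real n / 4)\<^sup>2"
      using m that by (intro divide_left_mono power_mono) auto
    finally show ?thesis by (simp add: power_divide)
  qed
  have "(\<lambda>n. singular_value A n) \<asymp> (\<lambda>n. 1 / (real n)\<^sup>2)"
    unfolding asymp_comparable_def
  proof (intro exI conjI)
    show "0 < 1 / (2 * pi)\<^sup>2" by simp
    \<comment> \<open>Only for the ordering of the two constants required by
      \<open>asymp_comparable\<close>.\<close>
    have "1 \<le> (2 * pi)\<^sup>2" using pi_ge_two by (intro one_le_power) simp
    then show "1 / (2 * pi)\<^sup>2 \<le> 144" by (simp add: divide_le_eq)
    show "\<forall>\<^sub>F n in sequentially. 1 / (2 * pi)\<^sup>2 * (1 / (real n)\<^sup>2) \<le> singular_value A n \<and>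
        singular_value A n \<le> 144 * (1 / (real n)\<^sup>2)"
      using eventually_ge_at_top[of 3] by eventually_elim (use ge le in auto)
  qed
  with compact ill_posed_of_degreeI[of A 2] show ?thesis by simp
qed

end
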